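(* Let $d \ge 1$ and $1 \le k \le \lfloor \frac{d+2}{2} \rfloor$ be integers. If $k \neq \frac{d+2}{2}$, then $$\Pr(X_d = k) = 2P(d+2,k).$$ If $k = \frac{d+2}{2}$, then $$\Pr(X_d = k) = P(d+2,k).$$
   Context: Radon's theorem: any $d+2$ points in $\mathbb{R}^d$ can be partitioned into two sets whose convex hulls intersect; such a partition is called a Radon partition, and if the points are in general position it is unique up to swapping the two sets. $X_d$ is the random variable equal to the number of points in the smaller side of the (almost surely unique) Radon partition of $d+2$ independent standard Gaussian points in $\mathbb{R}^d$. For $n$ independent samples $Z_1,\dots,Z_n \sim N(0,1)$ on the real line with sample mean $\bar Z = \frac1n\sum_{i=1}^n Z_i$, and $1\le k\le n-1$, $P(n,k)$ denotes the probability that $\bar Z$ lies between the $k$th largest and the $(k+1)$st largest of the samples. *)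

theory Defs
  imports "HOL-Probability.Probability"
begin

(* Parts of a partition are sets of indices, so repeated points are counted with multiplicity.
   Intersecting hulls force both parts to be nonempty. *)
definition radon_partition ::
    "'i set \<Rightarrow> ('i \<Rightarrow> 'e::real_vector) \<Rightarrow> 'i set \<Rightarrow> 'i set \<Rightarrow> bool" where
  "radon_partition I x A B \<longleftrightarrow>
     A \<union> B = I \<and> A \<inter> B = {} \<and> convex hull (x ` A) \<inter> convex hull (x ` B) \<noteq> {}"

(* The value is unspecified for configurations having Radon partitions with different smaller
   sizes. It depends on x only through the finite set of its Radon partitions, so for finite I
   the level sets are measurable whatever the unspecified value is. *)
definition radon_smaller_size :: "'i set \<Rightarrow> ('i \<Rightarrow> 'e::real_vector) \<Rightarrow> nat" where
  "radon_smaller_size I x =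
     (THE m. \<exists>A B. radon_partition I x A B \<and> m = min (card A) (card B))"

definition std_gaussian_density :: "real ^ 'd \<Rightarrow> real" where
  "std_gaussian_density x = (\<Prod>j\<in>UNIV. std_normal_density (x $ j))"

(* Meaningful for 1 \<le> k \<le> n; k = 1 gives the maximum. *)
definition kth_largest :: "nat \<Rightarrow> (nat \<Rightarrow> real) \<Rightarrow> nat \<Rightarrow> real" where
  "kth_largest n z k = rev (sort (map z [0..<n])) ! (k - 1)"

definition sample_mean :: "nat \<Rightarrow> (nat \<Rightarrow> real) \<Rightarrow> real" where
  "sample_mean n z = (\<Sum>i<n. z i) / real n"

definition mean_between_prob :: "nat \<Rightarrow> nat \<Rightarrow> real" where
  "mean_between_prob n k =
     (let N = Pi\<^sub>M {..<n} (\<lambda>_. std_normal_distribution)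
      in measure N {z \<in> space N. kth_largest n z (k + 1) \<le> sample_mean n z \<and>
                                 sample_mean n z \<le> kth_largest n z k})"

end

theory Submission
  imports Defs
begin

text \<open>
  Write the \<open>d + 2\<close> points as the rows of a matrix. A Radon partition is the sign pattern of an affine
  dependence of the rows, and for points in general position the affine dependence is unique up to a
  factor. Its direction is a random line in the hyperplane of vectors with coordinate sum 0, and it is
  equivariant under the orthogonal maps of the index space that fix the all-ones vector. Since the
  Gaussian measure is invariant under these maps, the line is uniformly distributed. The same holds
  for the line spanned by the centered sample \<open>Z - mean Z\<close>, so both have the same sign patterns up to
  a global sign. Exactly \<open>k\<close> of the centered samples are positive iff the mean lies between the
  \<open>k\<close>th and the \<open>(k + 1)\<close>st largest sample.
\<close>

subsection \<open>Orthogonal invariance of the Gaussian measure\<close>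

text \<open>The affine dependence must be a measurable function of the points, so it is not chosen
  from a kernel but written down by cofactors, which are polynomials in the coordinates. This
  formula is equivariant only up to the sign \<open>det R\<close>, and its length is not controlled.
  The two laws are therefore compared only on sets closed under multiplication by nonzero scalars,
  that is, as laws of lines. The event that the smaller sign class has \<open>k\<close> elements is
  of this kind; the event of exactly \<open>k\<close> positive coordinates in general is not.
  Passing from the first to the second produces the factor 2: either sign can be the smaller class,
  and the two cases are equally likely and disjoint, except for \<open>2 * k = d + 2\<close>, where
  they coincide.\<close>

text \<open>Uniqueness of Haar measure: the image measure is translation invariant, so Fubini applied to
  \<open>indicator A (f x + y) * indicator B y\<close> identifies it with \<open>lborel\<close> up to a factor, and the factor
  is 1 because \<open>f\<close> preserves the ball \<open>B\<close>.\<close>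

lemma distr_lborel_orthogonal:
  fixes f :: "'a::euclidean_space \<Rightarrow> 'a"
  assumes f: "orthogonal_transformation f"
  shows "distr lborel borel f = lborel"
proof -
  have lin: "linear f" using f by (rule orthogonal_transformation_linear)
  have [measurable]: "f \<in> borel_measurable borel"
    using lin by (intro borel_measurable_continuous_onI linear_continuous_on linear_linear[THEN iffD2])
  let ?M = "distr lborel borel f" and ?B = "ball (0::'a) 1"
  have [measurable]: "?B \<in> sets borel" by simp
  have fin: "emeasure lborel ?B \<noteq> \<infinity>"
    using emeasure_lborel_ball_finite[of "0::'a" 1] by simp
  have pos: "emeasure lborel ?B \<noteq> 0"
    using content_ball_pos[of 1 "0::'a"] by (auto simp: measure_def)
  have *: "emeasure ?M A * emeasure lborel ?B = emeasure lborel A * emeasure lborel ?B"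
    if [measurable]: "A \<in> sets borel" for A
  proof -
    \<comment> \<open>As \<open>f\<close> is onto, \<open>y\<close> is some \<open>f z\<close>, so
      the shift moves inside \<open>f\<close> and is absorbed by the translation invariance of
      \<open>lborel\<close>.\<close>
    have 1: "(\<integral>\<^sup>+x. indicator A (f x + y) \<partial>lborel) = emeasure ?M A" for y
    proof -
      obtain z where z: "y = f z" using orthogonal_transformation_surj[OF f] by (auto dest: surjD)
      have "(\<integral>\<^sup>+x. indicator A (f x + y) \<partial>lborel) = (\<integral>\<^sup>+x. indicator A (f (z + x)) \<partial>lborel)"
        by (simp add: z linear_add[OF lin] add.commute)
      also have "\<dots> = (\<integral>\<^sup>+x. indicator A (f x) \<partial>distr lborel borel ((+) z))"
        by (simp add: nn_integral_distr)
      also have "\<dots> = (\<integral>\<^sup>+x. indicator A x \<partial>?M)"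
        by (simp add: lborel_distr_plus nn_integral_distr del: nn_integral_indicator)
      finally show ?thesis by simp
    qed
    have 2: "(\<integral>\<^sup>+y. indicator A (w + y) * indicator ?B y \<partial>lborel)
             = (\<integral>\<^sup>+y. indicator A y * indicator ?B (y - w) \<partial>lborel)" for w
    proof -
      have [measurable]: "(\<lambda>y. indicator A y * indicator ?B (y - w) :: ennreal) \<in> borel_measurable borel"
        by measurable
      have "(\<integral>\<^sup>+y. indicator A y * indicator ?B (y - w) \<partial>lborel)
          = (\<integral>\<^sup>+y. indicator A y * indicator ?B (y - w) \<partial>distr lborel borel ((+) w))"
        by (simp add: lborel_distr_plus)
      also have "\<dots> = (\<integral>\<^sup>+y. indicator A (w + y) * indicator ?B y \<partial>lborel)"
        by (subst nn_integral_distr) simp_all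
      finally show ?thesis by simp
    qed
    have 3: "(\<integral>\<^sup>+x. indicator ?B (y - f x) \<partial>lborel) = emeasure lborel ?B" for y
    proof -
      obtain z where z: "y = f z" using orthogonal_transformation_surj[OF f] by (auto dest: surjD)
      have "indicator ?B (y - f x) = (indicator (ball z 1) x :: ennreal)" for x
        using orthogonal_transformation_norm[OF f, of "z - x"]
        by (simp add: z linear_diff[OF lin, symmetric] indicator_def dist_norm)
      then have "(\<integral>\<^sup>+x. indicator ?B (y - f x) \<partial>lborel) = emeasure lborel (ball z 1)"
        by simp
      also have "\<dots> = emeasure (distr lborel borel ((+) z)) (ball z 1)"
        by (simp add: lborel_distr_plus)
      also have "\<dots> = emeasure lborel ?B"
        by (subst emeasure_distr) (auto intro!: arg_cong[where f="emeasure lborel"] simp: dist_norm)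
      finally show ?thesis .
    qed
    have "emeasure ?M A * emeasure lborel ?B
        = (\<integral>\<^sup>+y. (\<integral>\<^sup>+x. indicator A (f x + y) * indicator ?B y \<partial>lborel) \<partial>lborel)"
      by (simp add: nn_integral_multc 1 nn_integral_cmult)
    also have "\<dots> = (\<integral>\<^sup>+x. (\<integral>\<^sup>+y. indicator A (f x + y) * indicator ?B y \<partial>lborel) \<partial>lborel)"
      by (rule lborel_pair.Fubini') measurable
    also have "\<dots> = (\<integral>\<^sup>+x. (\<integral>\<^sup>+y. indicator A y * indicator ?B (y - f x) \<partial>lborel) \<partial>lborel)"
      by (simp only: 2)
    also have "\<dots> = (\<integral>\<^sup>+y. (\<integral>\<^sup>+x. indicator A y * indicator ?B (y - f x) \<partial>lborel) \<partial>lborel)"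
      by (rule lborel_pair.Fubini') measurable
    also have "\<dots> = emeasure lborel A * emeasure lborel ?B"
      by (simp add: nn_integral_cmult 3 nn_integral_multc)
    finally show ?thesis .
  qed
  show ?thesis
  proof (rule measure_eqI)
    fix A assume "A \<in> sets ?M"
    then have "emeasure ?M A * emeasure lborel ?B = emeasure lborel A * emeasure lborel ?B"
      by (intro *) simp
    then show "emeasure ?M A = emeasure lborel A"
      using fin pos by (auto simp: mult.commute[of _ "emeasure lborel ?B"] ennreal_mult_cancel_left)
  qed simp
qed

text \<open>Defined on every Euclidean space, so that the same invariance serves point
  configurations, single points and samples; on \<open>real\<close> it is
  \<open>std_normal_distribution\<close>.\<close>

definition std_gauss :: "'a::euclidean_space measure" where
  "std_gauss = density lborel (\<lambda>x. ennreal (\<Prod>b\<in>Basis. std_normal_density (x \<bullet> b)))"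

lemma sets_std_gauss [simp, measurable_cong]: "sets std_gauss = sets borel"
  and space_std_gauss [simp]: "space std_gauss = UNIV"
  by (simp_all add: std_gauss_def)

text \<open>The source of the rotation invariance: the product density depends on the norm
  only.\<close>

lemma std_gauss_density_eq:
  "(\<Prod>b\<in>Basis. std_normal_density (x \<bullet> b))
     = (1 / sqrt (2 * pi)) ^ DIM('a) * exp (- (norm x)\<^sup>2 / 2)" for x :: "'a::euclidean_space"
proof -
  have "(norm x)\<^sup>2 = (\<Sum>b\<in>Basis. (x \<bullet> b)\<^sup>2)"
    unfolding power2_norm_eq_inner by (subst euclidean_inner) (simp add: power2_eq_square)
  then show ?thesis
    unfolding std_normal_density_def
    by (simp only: prod.distrib exp_sum[OF finite_Basis, symmetric] prod_constant sum_divide_distrib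
      sum_negf[symmetric])
qed

lemma emeasure_std_gauss_box:
  assumes [measurable]: "\<And>b::'a::euclidean_space. b \<in> Basis \<Longrightarrow> A b \<in> sets borel"
  shows "emeasure std_gauss {x::'a. \<forall>b\<in>Basis. x \<bullet> b \<in> A b}
           = (\<Prod>b\<in>Basis. emeasure std_normal_distribution (A b))"
proof -
  have "emeasure std_gauss {x::'a. \<forall>b\<in>Basis. x \<bullet> b \<in> A b}
      = (\<integral>\<^sup>+x. ennreal (\<Prod>b\<in>Basis. std_normal_density (x \<bullet> b))
              * indicator {x::'a. \<forall>b\<in>Basis. x \<bullet> b \<in> A b} x \<partial>lborel)"
    unfolding std_gauss_def by (rule emeasure_density) measurable
  also have "\<dots> = (\<integral>\<^sup>+x. (\<Prod>b\<in>Basis. ennreal (std_normal_density (x \<bullet> b)) * indicator (A b) (x \<bullet> b)) \<partial>(lborel :: 'a measure))"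
    by (intro nn_integral_cong) (auto simp: prod.distrib prod_ennreal indicator_def prod_zero_iff)
  also have "\<dots> = (\<Prod>b\<in>(Basis::'a set). (\<integral>\<^sup>+x. ennreal (std_normal_density x) * indicator (A b) x \<partial>lborel))"
    by (rule nn_integral_lborel_prod) auto
  also have "\<dots> = (\<Prod>b\<in>Basis. emeasure std_normal_distribution (A b))"
    by (intro prod.cong refl) (simp add: emeasure_density)
  finally show ?thesis .
qed

lemma prob_space_std_normal: "prob_space std_normal_distribution"
  by (simp add: prob_space_normal_density)

lemma prob_space_std_gauss: "prob_space (std_gauss :: 'a::euclidean_space measure)"
proof
  show "emeasure std_gauss (space std_gauss :: 'a set) = 1"
    using emeasure_std_gauss_box[of "\<lambda>_. UNIV"] prob_space.emeasure_space_1[OF prob_space_std_normal]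
    by simp
qed

text \<open>Recognises a vector of independent Gaussians, since independence yields the mass of a
  box as a product. Open boxes suffice for the proof: they are stable under intersection and
  generate the Borel sets.\<close>

lemma std_gauss_eqI:
  fixes M :: "'a::euclidean_space measure"
  assumes sets: "sets M = sets borel"
    and eq: "\<And>A. (\<And>b. b \<in> Basis \<Longrightarrow> A b \<in> sets borel) \<Longrightarrow>
      emeasure M {x. \<forall>b\<in>Basis. x \<bullet> b \<in> A b} = (\<Prod>b\<in>Basis. emeasure std_normal_distribution (A b))"
  shows "M = std_gauss"
proof (rule measure_eqI_generator_eq)
  let ?E = "range (\<lambda>(a, b). box a b::'a set)"
  show "Int_stable ?E"
    by (auto simp: Int_stable_def box_Int_box)
  show "?E \<subseteq> Pow UNIV" "sets M = sigma_sets UNIV ?E"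
      "sets (std_gauss :: 'a measure) = sigma_sets UNIV ?E"
    by (simp_all add: borel_eq_box sets)
  let ?A = "\<lambda>n::nat. box (- (real n *\<^sub>R One)) (real n *\<^sub>R One) :: 'a set"
  show "range ?A \<subseteq> ?E" "(\<Union>i. ?A i) = UNIV"
    unfolding UN_box_eq_UNIV by auto
  have *: "box l u = {x. \<forall>b\<in>Basis. x \<bullet> b \<in> {l \<bullet> b<..<u \<bullet> b}}" for l u :: 'a
    by (auto simp: box_def)
  have **: "emeasure M (box l u) = emeasure std_gauss (box l u)" for l u
    unfolding * by (subst eq, simp) (subst emeasure_std_gauss_box, simp_all)
  then show "emeasure M X = emeasure std_gauss X" if "X \<in> ?E" for X
    using that by auto
  interpret prob_space "std_gauss :: 'a measure" by (rule prob_space_std_gauss)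
  show "emeasure M (?A i) \<noteq> \<infinity>" for i
    unfolding ** by simp
qed

lemma distr_std_gauss_orthogonal:
  fixes f :: "'a::euclidean_space \<Rightarrow> 'a"
  assumes f: "orthogonal_transformation f"
  shows "distr std_gauss borel f = std_gauss"
proof (rule measure_eqI)
  have [measurable]: "f \<in> borel_measurable borel"
    using orthogonal_transformation_linear[OF f]
    by (intro borel_measurable_continuous_onI linear_continuous_on linear_linear[THEN iffD2])
  let ?g = "\<lambda>x::'a. ennreal (\<Prod>b\<in>Basis. std_normal_density (x \<bullet> b))"
  have g: "?g (f x) = ?g x" for x
    using orthogonal_transformation_norm[OF f, of x] by (simp add: std_gauss_density_eq)
  fix A assume "A \<in> sets (distr std_gauss borel f)"
  then have [measurable]: "A \<in> sets borel" by simp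
  have "emeasure (distr std_gauss borel f) A = emeasure std_gauss (f -` A)"
    by (subst emeasure_distr) auto
  also have "\<dots> = (\<integral>\<^sup>+x. ?g x * indicator (f -` A) x \<partial>lborel)"
    unfolding std_gauss_def
    by (rule emeasure_density) (use measurable_sets[of f borel borel A] in auto)
  also have "\<dots> = (\<integral>\<^sup>+x. ?g (f x) * indicator A (f x) \<partial>lborel)"
    by (simp add: g indicator_def)
  also have "\<dots> = (\<integral>\<^sup>+x. ?g x * indicator A x \<partial>distr lborel borel f)"
    by (subst nn_integral_distr) auto
  also have "\<dots> = emeasure std_gauss A"
    unfolding distr_lborel_orthogonal[OF f] std_gauss_def by (subst emeasure_density) auto
  finally show "emeasure (distr std_gauss borel f) A = emeasure std_gauss A" .
qed simp

lemma AE_std_gauss: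
  assumes "AE x in lborel. P x" shows "AE x in std_gauss. P (x::'a::euclidean_space)"
  using assms unfolding std_gauss_def by (subst AE_density) auto

subsection \<open>Uniqueness of the uniform law on lines\<close>

text \<open>By Cauchy--Schwarz, \<open>near r x y\<close> says that the lines through \<open>x\<close> and \<open>y\<close> enclose a small angle:
  the squared cosine exceeds \<open>1 - r\<close>.\<close>

definition near :: "real \<Rightarrow> 'a::real_inner \<Rightarrow> 'a \<Rightarrow> bool" where
  "near r x y \<longleftrightarrow> (1 - r) * (x \<bullet> x) * (y \<bullet> y) < (x \<bullet> y)\<^sup>2"

lemma near_commute: "near r x y \<longleftrightarrow> near r y x"
  by (simp add: near_def inner_commute mult_ac)

lemma near_self: "0 < r \<Longrightarrow> x \<noteq> 0 \<Longrightarrow> near r x x"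
  by (simp add: near_def power2_eq_square)

lemma near_scaleR: "c \<noteq> 0 \<Longrightarrow> near r (c *\<^sub>R x) y \<longleftrightarrow> near r x y"
proof -
  assume c: "c \<noteq> 0"
  have "near r (c *\<^sub>R x) y \<longleftrightarrow> c\<^sup>2 * ((1 - r) * (x \<bullet> x) * (y \<bullet> y)) < c\<^sup>2 * (x \<bullet> y)\<^sup>2"
    by (simp add: near_def power2_eq_square mult_ac)
  then show ?thesis using c by (simp add: near_def mult.assoc)
qed

lemma open_near: "open {y::'a::euclidean_space. near r x y}"
  unfolding near_def by (intro open_Collect_less continuous_intros)

lemma near_measurable [measurable]:
  "{p::'a::euclidean_space \<times> 'a. near r (fst p) (snd p)} \<in> sets (borel \<Otimes>\<^sub>M borel)"
proof -
  have "open {p::'a \<times> 'a. near r (fst p) (snd p)}"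
    unfolding near_def by (intro open_Collect_less continuous_intros)
  then show ?thesis unfolding borel_prod by (rule borel_open)
qed

text \<open>Nearness bounds the squared distance from \<open>x\<close> to its orthogonal projection
  on the line of \<open>y\<close> by \<open>r * (x \<bullet> x)\<close>. For small \<open>r\<close>
  the projection lies in a ball around \<open>x\<close> inside \<open>U\<close>, and the cone
  property scales it back to \<open>y\<close>.\<close>

lemma eventually_near_subset:
  fixes x :: "'a::euclidean_space"
  assumes "open U" "x \<in> U" "x \<noteq> 0" and cone: "\<And>c y. y \<in> U \<Longrightarrow> c \<noteq> 0 \<Longrightarrow> c *\<^sub>R y \<in> U"
  shows "\<forall>\<^sub>F k in sequentially. \<forall>y. y \<noteq> 0 \<longrightarrow> near (1 / real (Suc k)) x y \<longrightarrow> y \<in> U"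
proof -
  obtain e where e: "e > 0" "ball x e \<subseteq> U"
    using assms by (metis openE)
  have "(\<lambda>k. 1 / real (Suc k) * (x \<bullet> x)) \<longlonglongrightarrow> 0 * (x \<bullet> x)"
    by (intro tendsto_mult tendsto_const) (use LIMSEQ_inverse_real_of_nat in \<open>simp add: inverse_eq_divide\<close>)
  then have "\<forall>\<^sub>F k in sequentially. 1 / real (Suc k) * (x \<bullet> x) < e\<^sup>2"
    using e(1) by (intro order_tendstoD(2)) auto
  moreover have "\<forall>\<^sub>F k::nat in sequentially. k \<ge> 1" by (rule eventually_ge_at_top)
  ultimately show ?thesis
  proof eventually_elim
    case (elim k)
    show ?case
    proof (intro allI impI)
      fix y assume y: "y \<noteq> 0" and n: "near (1 / real (Suc k)) x y"
      let ?r = "1 / real (Suc k)"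
      define c where "c = (x \<bullet> y) / (y \<bullet> y)"
      have yy: "y \<bullet> y > 0" using y by simp
      have "(norm (x - c *\<^sub>R y))\<^sup>2 = x \<bullet> x - 2 * c * (x \<bullet> y) + c\<^sup>2 * (y \<bullet> y)"
        by (simp add: power2_norm_eq_inner inner_diff_left inner_diff_right inner_commute[of y x]
          power2_eq_square[of c] algebra_simps del: dot_square_norm power2_norm_eq_inner[symmetric])
      also have "\<dots> = x \<bullet> x - (x \<bullet> y)\<^sup>2 / (y \<bullet> y)"
        using yy by (simp add: c_def power2_eq_square field_simps)
      also have "\<dots> < ?r * (x \<bullet> x)"
        using n yy by (simp add: near_def field_simps)
      also have "\<dots> < e\<^sup>2" using elim by simp
      finally have "norm (x - c *\<^sub>R y) < e"
        using e(1) power_less_imp_less_base by fastforce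
      then have cU: "c *\<^sub>R y \<in> U" using e(2) by (auto simp: dist_norm)
      \<comment> \<open>As \<open>?r\<close> is at most 1, nearness excludes
        \<open>x \<bullet> y = 0\<close>; a zero projection could not be scaled back to
        \<open>y\<close>.\<close>
      have "0 \<le> (1 - ?r) * (x \<bullet> x) * (y \<bullet> y)"
        by (intro mult_nonneg_nonneg) auto
      then have "(x \<bullet> y)\<^sup>2 > 0" using n unfolding near_def by linarith
      then have "c \<noteq> 0" using yy by (auto simp: c_def)
      then show "y \<in> U" using cone[OF cU, of "1 / c"] by simp
    qed
  qed
qed

text \<open>If one cone were null, all cones of this aperture would be, and by Lindelof countably
  many of them cover \<open>V - {0}\<close>, which has full mass.\<close>

lemma emeasure_near_pos:
  fixes M :: "'a::euclidean_space measure"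
  assumes "prob_space M" and [simp]: "sets M = sets borel"
    and AE: "AE x in M. x \<in> V - {0}"
    and inv: "\<And>y y'. y \<in> V - {0} \<Longrightarrow> y' \<in> V - {0} \<Longrightarrow>
      emeasure M {x. near r x y} = emeasure M {x. near r x y'}"
    and r: "0 < r" and y: "y \<in> V - {0}"
  shows "emeasure M {x. near r x y} \<noteq> 0"
proof
  assume 0: "emeasure M {x. near r x y} = 0"
  interpret prob_space M by fact
  define N where "N v = {x. near r x v}" for v :: 'a
  have opn: "open (N v)" for v
    unfolding N_def near_commute[of r _ v] by (rule open_near)
  obtain \<G> where \<G>: "\<G> \<subseteq> N ` (V - {0})" "countable \<G>" "\<Union>\<G> = \<Union>(N ` (V - {0}))"
    using Lindelof[of "N ` (V - {0})"] opn by (metis (no_types, lifting) imageE)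
  have "\<Union>\<G> \<in> null_sets M"
  proof (rule null_sets_UN'[of \<G> "\<lambda>x. x", simplified])
    show "countable \<G>" by fact
    fix S assume "S \<in> \<G>"
    then obtain v where "v \<in> V - {0}" "S = N v" using \<G>(1) by auto
    then show "S \<in> null_sets M"
      using inv[OF y, of v] 0 opn[of v] by (auto simp: null_sets_def N_def)
  qed
  then have "AE x in M. x \<notin> \<Union>\<G>" by (rule AE_not_in)
  with AE have "AE x in M. False"
  proof eventually_elim
    case (elim x)
    then have "x \<in> N x" using r by (simp add: N_def near_self)
    then show False using elim \<G>(3) by auto
  qed
  then show False by simp
qed

text \<open>Christensen's argument for the uniqueness of uniformly distributed measures. The mass \<open>h r\<close> that
  a law gives to a cone of aperture \<open>r\<close> does not depend on the axis, and by Fubini it is the same for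
  both laws. For \<open>x\<close> in \<open>U\<close> the cone around \<open>x\<close> is eventually contained in \<open>U\<close>, so Fatou's lemma and
  Fubini compare the two masses of \<open>U\<close>.\<close>

lemma directional_law_le:
  fixes M N :: "'a::euclidean_space measure"
  assumes "prob_space M" "prob_space N"
    and [measurable_cong, simp]: "sets M = sets borel" "sets N = sets borel"
    and AEM: "AE x in M. x \<in> V - {0}" and AEN: "AE x in N. x \<in> V - {0}"
    and invM: "\<And>r y y'. 0 < r \<Longrightarrow> y \<in> V - {0} \<Longrightarrow> y' \<in> V - {0} \<Longrightarrow>
      emeasure M {x. near r x y} = emeasure M {x. near r x y'}"
    and invN: "\<And>r y y'. 0 < r \<Longrightarrow> y \<in> V - {0} \<Longrightarrow> y' \<in> V - {0} \<Longrightarrow>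
      emeasure N {x. near r x y} = emeasure N {x. near r x y'}"
    and U: "open U" and cone: "\<And>c y. y \<in> U \<Longrightarrow> c \<noteq> 0 \<Longrightarrow> c *\<^sub>R y \<in> U"
  shows "emeasure M U \<le> emeasure N U"
proof -
  interpret M: prob_space M by fact
  interpret N: prob_space N by fact
  interpret P: pair_sigma_finite M N ..
  have [simp]: "space M = UNIV" "space N = UNIV"
    using sets_eq_imp_space_eq[of M borel] sets_eq_imp_space_eq[of N borel] by simp_all
  have [measurable]: "U \<in> sets borel" using U by (rule borel_open)
  obtain y0 where y0: "y0 \<in> V - {0}"
    using M.AE_E_prob AEM by (metis (no_types, lifting) AE_E2 M.AE_False eventually_mono)
  define h where "h r = emeasure M {x. near r x y0}" for r
  define I where "I r x y = (if near r x y then 1 else 0::ennreal)" for r and x y :: 'a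
  have [measurable]: "case_prod (I r) \<in> borel_measurable (borel \<Otimes>\<^sub>M borel)" for r
  proof -
    have "case_prod (I r) = indicator {p. near r (fst p) (snd p)}"
      by (auto simp: I_def indicator_def fun_eq_iff)
    then show ?thesis by simp
  qed
  have IM: "(\<integral>\<^sup>+x. I r x y \<partial>M) = h r" if "y \<in> V - {0}" "0 < r" for y r
  proof -
    have "I r x y = indicator {x. near r x y} x" for x by (simp add: I_def)
    moreover have "{x. near r x y} \<in> sets borel"
      using open_near[of r y] by (auto simp: near_commute[of r _ y] intro: borel_open)
    ultimately show ?thesis using invM[OF that(2) y0 that(1)] by (simp add: h_def)
  qed
  have IN: "(\<integral>\<^sup>+y. I r x y \<partial>N) = emeasure N {x. near r x y0}" if "x \<in> V - {0}" "0 < r" for x r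
  proof -
    have "I r x y = indicator {y. near r y x} y" for y by (simp add: I_def near_commute)
    moreover have "{y. near r y x} \<in> sets borel"
      using open_near[of r x] by (auto simp: near_commute[of r _ x] intro: borel_open)
    ultimately show ?thesis using invN[OF that(2) y0 that(1)] by simp
  qed
  have hN: "emeasure N {x. near r x y0} = h r" if r: "0 < r" for r
  proof -
    have "h r = (\<integral>\<^sup>+y. h r \<partial>N)" by (simp add: N.emeasure_space_1[simplified])
    also have "\<dots> = (\<integral>\<^sup>+y. (\<integral>\<^sup>+x. I r x y \<partial>M) \<partial>N)"
      by (rule nn_integral_cong_AE) (use AEN IM[OF _ r] in auto)
    also have "\<dots> = (\<integral>\<^sup>+x. (\<integral>\<^sup>+y. I r x y \<partial>N) \<partial>M)"
      by (rule P.Fubini') measurable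
    also have "\<dots> = (\<integral>\<^sup>+x. emeasure N {x. near r x y0} \<partial>M)"
      by (rule nn_integral_cong_AE) (use AEM IN[OF _ r] in auto)
    also have "\<dots> = emeasure N {x. near r x y0}" by (simp add: M.emeasure_space_1[simplified])
    finally show ?thesis by simp
  qed
  define r where "r k = 1 / real (Suc k)" for k
  have r: "0 < r k" for k by (simp add: r_def)
  have h0: "h (r k) \<noteq> 0" "h (r k) \<noteq> \<infinity>" for k
    using emeasure_near_pos[OF \<open>prob_space M\<close> _ AEM invM r y0] r by (auto simp: h_def)
  \<comment> \<open>For \<open>x\<close> in \<open>U\<close>, the share of the \<open>N\<close>-mass
    of the cone around \<open>x\<close> that falls into \<open>U\<close>; by \<open>hN\<close> the
    whole cone has mass \<open>h (r k)\<close>.\<close>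
  define f where "f k x = indicator U x * ((\<integral>\<^sup>+y. indicator U y * I (r k) x y \<partial>N) / h (r k))" for k x
  have [measurable]: "f k \<in> borel_measurable M" for k
    unfolding f_def by measurable
  have lim: "AE x in M. indicator U x \<le> liminf (\<lambda>k. f k x)"
    using AEM
  proof eventually_elim
    case (elim x)
    show ?case
    proof (cases "x \<in> U")
      case True
      have "\<forall>\<^sub>F k in sequentially. 1 \<le> f k x"
        using eventually_near_subset[OF U True _ cone] elim
      proof (simp, elim eventually_mono)
        fix k assume k: "\<forall>y. y \<noteq> 0 \<longrightarrow> near (1 / (1 + real k)) x y \<longrightarrow> y \<in> U"
        have "(\<integral>\<^sup>+y. indicator U y * I (r k) x y \<partial>N) = (\<integral>\<^sup>+y. I (r k) x y \<partial>N)"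
          by (rule nn_integral_cong_AE) (use AEN k in \<open>auto simp: I_def r_def\<close>)
        also have "\<dots> = h (r k)" using IN[OF _ r] elim hN[OF r] by simp
        finally show "1 \<le> f k x" using True h0[of k] by (simp add: f_def ennreal_divide_self top.not_eq_extremum)
      qed
      then have "1 \<le> liminf (\<lambda>k. f k x)" by (rule Liminf_bounded)
      then show ?thesis using True by simp
    qed simp
  qed
  \<comment> \<open>Integrating over \<open>x\<close> first leaves at most the \<open>M\<close>-mass
    of the cone around \<open>y\<close>, which is again \<open>h (r k)\<close> and cancels the
    denominator.\<close>
  have f_le: "(\<integral>\<^sup>+x. f k x \<partial>M) \<le> emeasure N U" for k
  proof -
    have "(\<integral>\<^sup>+x. f k x \<partial>M)
        = (\<integral>\<^sup>+x. (\<integral>\<^sup>+y. indicator U x * (indicator U y * I (r k) x y) \<partial>N) \<partial>M) / h (r k)"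
      by (simp add: f_def nn_integral_cmult nn_integral_divide[symmetric, of _ M] ennreal_times_divide)
    also have "(\<integral>\<^sup>+x. (\<integral>\<^sup>+y. indicator U x * (indicator U y * I (r k) x y) \<partial>N) \<partial>M)
        = (\<integral>\<^sup>+y. (\<integral>\<^sup>+x. indicator U x * (indicator U y * I (r k) x y) \<partial>M) \<partial>N)"
      by (rule P.Fubini'[symmetric]) measurable
    also have "\<dots> \<le> (\<integral>\<^sup>+y. indicator U y * h (r k) \<partial>N)"
    proof (rule nn_integral_mono_AE)
      show "AE y in N. (\<integral>\<^sup>+x. indicator U x * (indicator U y * I (r k) x y) \<partial>M) \<le> indicator U y * h (r k)"
        using AEN
      proof eventually_elim
        case (elim y)
        have "(\<integral>\<^sup>+x. indicator U x * (indicator U y * I (r k) x y) \<partial>M) \<le> (\<integral>\<^sup>+x. indicator U y * I (r k) x y \<partial>M)"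
          by (intro nn_integral_mono) (auto simp: indicator_def)
        also have "\<dots> = indicator U y * h (r k)"
          using IM[OF elim r] by (simp add: nn_integral_cmult)
        finally show ?case .
      qed
    qed
    also have "\<dots> = emeasure N U * h (r k)" by (simp add: nn_integral_multc)
    finally show ?thesis
      using h0[of k] by (simp add: divide_right_mono_ennreal ennreal_mult_divide_eq)
  qed
  have "emeasure M U = (\<integral>\<^sup>+x. indicator U x \<partial>M)" by simp
  also have "\<dots> \<le> (\<integral>\<^sup>+x. liminf (\<lambda>k. f k x) \<partial>M)" by (rule nn_integral_mono_AE) (rule lim)
  also have "\<dots> \<le> liminf (\<lambda>k. \<integral>\<^sup>+x. f k x \<partial>M)" by (rule nn_integral_liminf) measurable
  also have "\<dots> \<le> limsup (\<lambda>k. \<integral>\<^sup>+x. f k x \<partial>M)" by (rule Liminf_le_Limsup) simp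
  also have "\<dots> \<le> emeasure N U" by (rule Limsup_bounded) (simp_all add: f_le)
  finally show ?thesis .
qed

subsection \<open>The affine dependence as a vector of cofactors\<close>

text \<open>The index type \<open>'d option option\<close> has \<open>CARD('d) + 2\<close> elements. It indexes the points, and also the
  rows of \<open>dep_matrix\<close>: a free row, the all-ones row, and one row for each coordinate. Expanding
  the determinant along the free row gives a vector orthogonal to all the other rows.\<close>

definition dep_matrix ::
    "real^'d^('d option option) \<Rightarrow> real^('d option option) \<Rightarrow> real^('d option option)^('d option option)" where
  "dep_matrix x w = (\<chi> c. case c of None \<Rightarrow> w | Some None \<Rightarrow> 1 | Some (Some j) \<Rightarrow> column j x)"

definition aff_dep :: "real^'d^('d option option) \<Rightarrow> real^('d option option)" where
  "aff_dep x = (\<chi> i. det (dep_matrix x (axis i 1)))"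

lemma all_option_option: "(\<forall>c. P c) \<longleftrightarrow> P None \<and> P (Some None) \<and> (\<forall>j. P (Some (Some j)))"
  by (metis option.exhaust)

lemma dep_matrix_nth [simp]:
  "dep_matrix x w $ None = w" "dep_matrix x w $ Some None = 1"
  "dep_matrix x w $ Some (Some j) = column j x"
  by (simp_all add: dep_matrix_def)

lemma linear_det_dep_matrix: "linear (\<lambda>w. det (dep_matrix x w))"
proof -
  define b where "b c = (case c of None \<Rightarrow> 0 | Some None \<Rightarrow> 1 | Some (Some j) \<Rightarrow> column j x)" for c
  have eq: "dep_matrix x w = (\<chi> c. if c = None then w else b c)" for w
    by (simp add: vec_eq_iff b_def dep_matrix_def split: option.split)
  show ?thesis
  proof (rule linearI)
    show "det (dep_matrix x (v + w)) = det (dep_matrix x v) + det (dep_matrix x w)" for v w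
      unfolding eq by (rule det_row_add)
    show "det (dep_matrix x (c *\<^sub>R w)) = c *\<^sub>R det (dep_matrix x w)" for c w
      unfolding eq using det_row_mul[of None c "\<lambda>_. w" b] by (simp add: scalar_mult_eq_scaleR cong: if_cong)
  qed
qed

text \<open>Cofactor expansion along the free row, obtained from linearity in that row.
  Orthogonality to the other rows then follows from repeated rows.\<close>

lemma inner_aff_dep: "aff_dep x \<bullet> w = det (dep_matrix x w)"
proof -
  have "det (dep_matrix x w) = det (dep_matrix x (\<Sum>i\<in>UNIV. w $ i *\<^sub>R axis i 1))"
    by (simp add: basis_expansion scalar_mult_eq_scaleR[symmetric])
  also have "\<dots> = (\<Sum>i\<in>UNIV. w $ i * det (dep_matrix x (axis i 1)))"
    by (simp add: linear_sum[OF linear_det_dep_matrix] linear_scale[OF linear_det_dep_matrix])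
  also have "\<dots> = aff_dep x \<bullet> w"
    by (simp add: inner_vec_def aff_dep_def mult.commute)
  finally show ?thesis by simp
qed

lemma inner_aff_dep_one: "aff_dep x \<bullet> 1 = 0"
  unfolding inner_aff_dep by (rule det_identical_rows[of None "Some None"]) (simp_all add: row_def)

lemma inner_aff_dep_column: "aff_dep x \<bullet> column j x = 0"
  unfolding inner_aff_dep
  by (rule det_identical_rows[of None "Some (Some j)"]) (simp_all add: row_def)

text \<open>With \<open>aff_dep x\<close> itself in the free row the determinant is its squared
  norm, hence nonzero. The part of \<open>c\<close> orthogonal to \<open>aff_dep x\<close> is
  annihilated by all rows of this invertible matrix.\<close>

lemma aff_dep_unique:
  assumes nz: "aff_dep x \<noteq> 0" and 1: "c \<bullet> 1 = 0" and col: "\<And>j. c \<bullet> column j x = 0"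
  shows "\<exists>t. c = t *\<^sub>R aff_dep x"
proof -
  let ?v = "aff_dep x" and ?M = "dep_matrix x (aff_dep x)"
  have "det ?M \<noteq> 0" using nz by (simp add: inner_aff_dep[symmetric])
  then have inj: "?M *v y = 0 \<Longrightarrow> y = 0" for y
    by (metis invertible_det_nz invertible_def matrix_left_invertible_ker)
  let ?y = "c - ((c \<bullet> ?v) / (?v \<bullet> ?v)) *\<^sub>R ?v"
  have "?M *v ?y = 0"
    unfolding vec_eq_iff matrix_vector_mul_component all_option_option
    using nz 1 col inner_aff_dep_one[of x] inner_aff_dep_column[of x]
    by (simp add: inner_diff_right inner_commute)
  then have "?y = 0" by (rule inj)
  then show ?thesis by (intro exI[of _ "(c \<bullet> ?v) / (?v \<bullet> ?v)"]) simp
qed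

lemma continuous_aff_dep: "continuous_on UNIV aff_dep"
proof -
  have *: "continuous_on UNIV (\<lambda>x. dep_matrix x w $ c $ i)" for w c i
  proof (cases c)
    case (Some u)
    then show ?thesis by (cases u) (auto simp: column_def intro!: continuous_intros)
  qed simp
  then show ?thesis
    unfolding aff_dep_def det_def
    by (intro continuous_on_vec_lambda continuous_on_sum continuous_on_mult continuous_on_prod continuous_on_const *)
qed

section \<open>Equivariance of the cofactor vector\<close>

lemma column_matrix_mul: "column j (A ** B) = A *v column j B"
  by (simp add: vec_eq_iff column_def matrix_matrix_mult_def matrix_vector_mult_def)

text \<open>Because \<open>R\<close> fixes the all-ones row, applying \<open>R\<close> to every row
  of \<open>dep_matrix x w\<close> gives the dependence matrix of \<open>R ** x\<close> with free
  row \<open>R *v w\<close>. The determinant is multiplied by \<open>det R\<close>, and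
  orthogonality moves \<open>R\<close> to the other side of the inner product.\<close>

lemma aff_dep_orthogonal:
  assumes R: "orthogonal_matrix R" and R1: "R *v 1 = 1"
  shows "aff_dep (R ** (x :: real^'d^('d option option))) = det R *\<^sub>R (R *v aff_dep x)"
proof -
  have tR: "transpose R ** R = mat 1" "R ** transpose R = mat 1"
    using R by (auto simp: orthogonal_matrix_def)
  have eq: "dep_matrix (R ** x) (R *v w) = dep_matrix x w ** transpose R" for w
  proof -
    have row: "(A ** transpose R) $ c = R *v (A $ c)" for A :: "real^('d option option)^('d option option)" and c
      by (simp add: vec_eq_iff matrix_matrix_mult_def matrix_vector_mult_def transpose_def mult.commute)
    show ?thesis
      by (subst vec_eq_iff) (simp add: row all_option_option R1 column_matrix_mul)
  qed
  have "aff_dep (R ** x) \<bullet> w = (det R *\<^sub>R (R *v aff_dep x)) \<bullet> w" for w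
  proof -
    have w: "w = R *v (transpose R *v w)" by (simp only: matrix_vector_mul_assoc tR matrix_vector_mul_lid)
    have "aff_dep (R ** x) \<bullet> w = det (dep_matrix (R ** x) (R *v (transpose R *v w)))"
      using w by (simp add: inner_aff_dep)
    also have "\<dots> = det R * (aff_dep x \<bullet> (transpose R *v w))"
      by (simp only: eq det_mul det_transpose inner_aff_dep mult.commute)
    also have "\<dots> = (det R *\<^sub>R (R *v aff_dep x)) \<bullet> w"
      by (simp add: inner_commute[of "aff_dep x"] dot_lmul_matrix inner_commute[of w])
    finally show ?thesis .
  qed
  then show ?thesis by (metis vector_eq_rdot)
qed

text \<open>All translates of \<open>N\<close> along \<open>a\<close> have the same mass.
  Integrating it over all shifts \<open>t\<close> gives infinity times the mass of \<open>N\<close>,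
  while in the other order each line meets \<open>N\<close> in a null set of parameters, so the
  double integral is 0.\<close>

lemma AE_lborel_translates:
  fixes N :: "'a::euclidean_space set"
  assumes [measurable]: "N \<in> sets borel" and N: "\<And>x. countable {t::real. x + t *\<^sub>R a \<in> N}"
  shows "AE x in lborel. x \<notin> N"
proof -
  have shift: "(\<integral>\<^sup>+x. indicator N (x + t *\<^sub>R a) \<partial>lborel) = emeasure lborel N" for t
  proof -
    have "(\<integral>\<^sup>+x. indicator N x \<partial>distr lborel borel ((+) (t *\<^sub>R a))) = emeasure lborel N"
      by (simp add: lborel_distr_plus)
    then show ?thesis by (simp add: nn_integral_distr add.commute del: nn_integral_indicator)
  qed
  have "emeasure lborel N * \<infinity> = (\<integral>\<^sup>+t. (\<integral>\<^sup>+x. indicator N (x + t *\<^sub>R a) \<partial>lborel) \<partial>(lborel :: real measure))"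
    by (simp add: shift)
  also have "\<dots> = (\<integral>\<^sup>+x. (\<integral>\<^sup>+t. indicator N (x + t *\<^sub>R a) \<partial>(lborel :: real measure)) \<partial>lborel)"
    by (rule lborel_pair.Fubini') measurable
  also have "\<dots> = 0"
  proof -
    have "(\<integral>\<^sup>+t. indicator N (x + t *\<^sub>R a) \<partial>(lborel :: real measure)) = 0" for x
    proof -
      have "(\<integral>\<^sup>+t. indicator N (x + t *\<^sub>R a) \<partial>(lborel :: real measure))
          = (\<integral>\<^sup>+t. indicator {t. x + t *\<^sub>R a \<in> N} t \<partial>lborel)"
        by (intro nn_integral_cong) (simp add: indicator_def)
      also have "\<dots> = emeasure lborel {t. x + t *\<^sub>R a \<in> N}"
        by (rule nn_integral_indicator) measurable
      also have "\<dots> = 0" using N by (rule emeasure_lborel_countable)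
      finally show ?thesis .
    qed
    then show ?thesis by simp
  qed
  finally have "emeasure lborel N = 0" by (auto simp: ennreal_mult_eq_top_iff)
  then show ?thesis by (intro AE_not_in) (auto simp: null_sets_def)
qed

text \<open>Along every line in a suitable direction \<open>a\<close> the determinant is a nonzero polynomial, so it
  vanishes at finitely many points only.\<close>

lemma AE_aff_dep_nonzero: "AE x in lborel. aff_dep (x :: real^'d^('d option option)) \<noteq> 0"
proof -
  \<comment> \<open>The configuration \<open>a\<close> puts point \<open>Some (Some j)\<close> at
    the \<open>j\<close>th unit vector and the other two points at the origin. With \<open>w\<close>
    as free row, all rows of the matrix are unit vectors except the all-ones row, so it is
    invertible.\<close>
  define w :: "real^('d option option)" where "w = axis None 1"
  define a :: "real^'d^('d option option)" where "a = (\<chi> i j. if i = Some (Some j) then 1 else 0)"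
  let ?f = "\<lambda>x. det (dep_matrix x w)"
  have fa: "?f a \<noteq> 0"
  proof -
    have "y = 0" if "dep_matrix a w *v y = 0" for y
    proof -
      have N: "y $ None = 0" and S: "1 \<bullet> y = 0" and J: "y $ Some (Some j) = 0" for j
        using that unfolding vec_eq_iff matrix_vector_mul_component all_option_option
        by (simp_all add: w_def inner_axis') (simp add: column_def a_def inner_vec_def
            if_distrib[of "\<lambda>x. x * _"] cong: if_cong)
      have "1 \<bullet> y = (\<Sum>i\<in>{Some None}. y $ i)"
        unfolding inner_vec_def using N J
        by (simp only: one_index inner_real_def mult_1) (rule sum.mono_neutral_right, auto, metis not_None_eq)
      then have "y $ Some None = 0" using S by simp
      then show ?thesis using N J by (simp add: vec_eq_iff all_option_option)
    qed
    then show ?thesis by (metis invertible_det_nz invertible_left_inverse matrix_left_invertible_ker)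
  qed
  have cont: "continuous_on UNIV ?f"
    unfolding inner_aff_dep[symmetric] by (intro continuous_intros continuous_aff_dep)
  have scale: "\<exists>c. ?f (s *\<^sub>R x) = c * ?f x" for s x
  proof -
    define g where "g = (\<lambda>c::'d option option. case c of Some (Some j) \<Rightarrow> s | _ \<Rightarrow> 1)"
    have "dep_matrix (s *\<^sub>R x) w = (\<chi> i. g i *s (dep_matrix x w $ i))"
      by (subst vec_eq_iff) (simp add: all_option_option g_def vec_eq_iff column_def)
    then show ?thesis using det_rows_mul[of g "\<lambda>i. dep_matrix x w $ i"] by auto
  qed
  have fin: "finite {t. ?f (x + t *\<^sub>R a) = 0}" for x
  proof -
    define B where "B = (\<lambda>c i. case c of Some (Some j) \<Rightarrow> a $ i $ j | _ \<Rightarrow> 0)"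
    define P :: "real poly" where "P = det (\<chi> c i. [:dep_matrix x w $ c $ i, B c i:])"
    have "dep_matrix (x + t *\<^sub>R a) w $ c $ i = dep_matrix x w $ c $ i + t * B c i" for t c i
      by (cases c; cases "the c") (auto simp: B_def column_def)
    then have P: "poly P t = ?f (x + t *\<^sub>R a)" for t
      by (simp add: P_def det_def poly_sum poly_prod)
    \<comment> \<open>Substitutes \<open>t = 1 / s\<close>: for small positive \<open>s\<close> the
      value is close to \<open>?f a\<close>, hence nonzero, and by \<open>scale\<close> so is
      \<open>P\<close> at \<open>1 / s\<close>. This avoids computing the leading coefficient of
      \<open>P\<close>.\<close>
    have "((\<lambda>s. ?f (s *\<^sub>R x + a)) \<longlongrightarrow> ?f (0 *\<^sub>R x + a)) (at_right 0)"
      by (intro continuous_on_tendsto_compose[OF cont] tendsto_intros) auto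
    then have "\<forall>\<^sub>F s in at_right 0. ?f (s *\<^sub>R x + a) \<noteq> 0"
      using fa by (intro tendsto_imp_eventually_ne) auto
    moreover have "\<forall>\<^sub>F s::real in at_right 0. s > 0" by (rule eventually_at_right_less)
    ultimately have "\<forall>\<^sub>F s::real in at_right 0. s > 0 \<and> ?f (s *\<^sub>R x + a) \<noteq> 0"
      by (rule eventually_conj[rotated])
    then obtain s where s: "s > 0" "?f (s *\<^sub>R x + a) \<noteq> 0"
      by (auto dest!: eventually_happens)
    have "s *\<^sub>R x + a = s *\<^sub>R (x + (1 / s) *\<^sub>R a)" using s(1) by (simp add: scaleR_add_right)
    then have "?f (x + (1 / s) *\<^sub>R a) \<noteq> 0" using s(2) scale[of s "x + (1 / s) *\<^sub>R a"] by auto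
    then have "P \<noteq> 0" using P by auto
    then show ?thesis using poly_roots_finite[of P] by (simp add: P)
  qed
  have "closed {x. ?f x = 0}"
    using continuous_closed_preimage_constant[OF cont closed_UNIV, of 0] by simp
  then have "AE x in lborel. x \<notin> {x. ?f x = 0}"
    by (intro AE_lborel_translates[of _ a]) (simp_all add: borel_closed countable_finite[OF fin])
  then show ?thesis
    by eventually_elim (auto simp: inner_aff_dep[symmetric])
qed

subsection \<open>Equality of the two laws\<close>

text \<open>Used for the configuration of random points, where the entries are vectors, and for the
  sample on the line, where they are reals. The bijection passes from numbered variables to an index
  type.\<close>

lemma distr_vec_std_gauss:
  fixes Y :: "'i \<Rightarrow> 'a \<Rightarrow> 'e::euclidean_space" and \<sigma> :: "'m::finite \<Rightarrow> 'i"
  assumes "prob_space M"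
    and indep: "prob_space.indep_vars M (\<lambda>_. borel) Y I"
    and \<sigma>: "bij_betw \<sigma> UNIV I"
    and law: "\<And>i. i \<in> I \<Longrightarrow> distr M borel (Y i) = std_gauss"
  shows "(\<lambda>\<omega>. \<chi> i. Y (\<sigma> i) \<omega>) \<in> borel_measurable M"
    and "distr M borel (\<lambda>\<omega>. \<chi> i. Y (\<sigma> i) \<omega>) = (std_gauss :: ('e^'m) measure)"
proof -
  interpret prob_space M by fact
  have [measurable]: "Y j \<in> borel_measurable M" if "j \<in> I" for j
    using indep that unfolding indep_vars_def by auto
  have \<sigma>I [simp]: "\<sigma> i \<in> I" for i using \<sigma> by (auto simp: bij_betw_def)
  have I: "I \<noteq> {}" "finite I" using \<sigma> by (auto simp: bij_betw_def)
  let ?Z = "\<lambda>\<omega>. (\<chi> i. Y (\<sigma> i) \<omega>) :: 'e^'m"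
  show meas: "?Z \<in> borel_measurable M"
    unfolding borel_measurable_euclidean_space[of ?Z]
    by (auto simp: Basis_vec_def inner_axis)
  show "distr M borel ?Z = std_gauss"
  proof (rule std_gauss_eqI)
    fix A :: "'e^'m \<Rightarrow> real set" assume A: "\<And>b. b \<in> Basis \<Longrightarrow> A b \<in> sets borel"
    define B where "B i = {v::'e. \<forall>c\<in>Basis. v \<bullet> c \<in> A (axis i c)}" for i
    have Ab [measurable]: "c \<in> Basis \<Longrightarrow> A (axis i c) \<in> sets borel" for i c
      by (rule A) (auto simp: Basis_vec_def)
    have [measurable]: "B i \<in> sets borel" for i
      unfolding B_def by measurable
    let ?S = "{x. \<forall>b\<in>Basis. x \<bullet> b \<in> A b}"
    have [measurable]: "?S \<in> sets borel" using A by measurable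
    let ?i = "inv_into UNIV \<sigma>"
    have inv: "?i (\<sigma> i) = i" for i using \<sigma> by (auto simp: bij_betw_def)
    have "emeasure (distr M borel ?Z) ?S = emeasure M (\<Inter>j\<in>I. Y j -` B (?i j) \<inter> space M)"
    proof (subst emeasure_distr[OF meas])
      have "?Z -` ?S \<inter> space M = (\<Inter>i. Y (\<sigma> i) -` B i \<inter> space M)"
        using I by (auto simp: Basis_vec_def inner_axis B_def)
      also have "\<dots> = (\<Inter>j\<in>range \<sigma>. Y j -` B (?i j) \<inter> space M)"
        unfolding image_image inv ..
      finally show "emeasure M (?Z -` ?S \<inter> space M) = emeasure M (\<Inter>j\<in>I. Y j -` B (?i j) \<inter> space M)"
        unfolding bij_betw_imp_surj_on[OF \<sigma>] by (rule arg_cong)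
    qed simp
    also have "\<dots> = ennreal (\<Prod>j\<in>I. prob (Y j -` B (?i j) \<inter> space M))"
      unfolding emeasure_eq_measure by (subst indep_varsD_finite[OF indep I]) simp_all
    also have "\<dots> = (\<Prod>j\<in>I. emeasure M (Y j -` B (?i j) \<inter> space M))"
      by (simp add: prod_ennreal emeasure_eq_measure)
    also have "\<dots> = (\<Prod>j\<in>I. emeasure std_gauss (B (?i j)))"
      by (intro prod.cong refl) (simp add: law[symmetric] emeasure_distr)
    also have "\<dots> = (\<Prod>i\<in>UNIV. emeasure std_gauss (B i))"
      by (subst prod.reindex_bij_betw[OF \<sigma>, symmetric]) (simp add: inv)
    also have "\<dots> = (\<Prod>i\<in>UNIV. \<Prod>c\<in>Basis. emeasure std_normal_distribution (A (axis i c)))"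
      unfolding B_def by (intro prod.cong refl emeasure_std_gauss_box Ab)
    also have "\<dots> = (\<Prod>p\<in>UNIV \<times> Basis. emeasure std_normal_distribution (A (case p of (i, c) \<Rightarrow> axis i c)))"
      by (simp add: prod.cartesian_product split_def)
    also have "\<dots> = (\<Prod>b\<in>(\<lambda>(i, c). axis i c) ` (UNIV \<times> Basis). emeasure std_normal_distribution (A b))"
      by (subst prod.reindex) (auto simp: inj_on_def axis_eq_axis)
    also have "(\<lambda>(i, c). axis i c) ` (UNIV \<times> Basis) = (Basis :: ('e^'m) set)"
      by (auto simp: Basis_vec_def)
    finally show "emeasure (distr M borel ?Z) ?S = (\<Prod>b\<in>Basis. emeasure std_normal_distribution (A b))" .
  qed simp
qed

text \<open>The reflection in the hyperplane orthogonal to \<open>y - y'\<close>. Equal norms make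
  this hyperplane bisect the segment from \<open>y\<close> to \<open>y'\<close>; the vectors
  \<open>u\<close> of the last clause are those in the hyperplane.\<close>

lemma reflection_swapping:
  fixes y y' :: "'a::euclidean_space"
  assumes eq: "norm y = norm y'"
  obtains f where "orthogonal_transformation f" "f y = y'" "\<And>u. u \<bullet> y = u \<bullet> y' \<Longrightarrow> f u = u"
proof -
  define w where "w = y - y'"
  define f where "f u = u - (2 * (u \<bullet> w) / (w \<bullet> w)) *\<^sub>R w" for u
  have ww: "w \<bullet> w = 2 * (y \<bullet> w)"
    using eq by (simp add: w_def inner_diff_left inner_diff_right norm_eq inner_commute)
  have "f y = y'"
  proof (cases "w = 0")
    case False
    then have "w \<bullet> w \<noteq> 0" by simp
    then have "2 * (y \<bullet> w) / (w \<bullet> w) = 1" unfolding ww[symmetric] by (rule divide_self)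
    then have "f y = y - 1 *\<^sub>R w" by (simp only: f_def)
    then show ?thesis by (simp add: w_def)
  qed (simp add: f_def w_def)
  moreover have "orthogonal_transformation f"
    unfolding orthogonal_transformation_def
  proof (intro conjI allI)
    show "linear f"
      by (rule linearI) (simp_all add: f_def inner_add_left algebra_simps add_divide_distrib)
    show "f u \<bullet> f v = u \<bullet> v" for u v
    proof (cases "w = 0")
      case False
      define a b where "a = 2 * (u \<bullet> w) / (w \<bullet> w)" and "b = 2 * (v \<bullet> w) / (w \<bullet> w)"
      have "w \<bullet> w \<noteq> 0" using False by simp
      then have a: "u \<bullet> w = a * (w \<bullet> w) / 2" and b: "v \<bullet> w = b * (w \<bullet> w) / 2"
        by (simp_all only: a_def b_def) simp_all
      have "f u \<bullet> f v = u \<bullet> v - b * (u \<bullet> w) - a * (v \<bullet> w) + a * b * (w \<bullet> w)"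
        by (simp add: f_def a_def[symmetric] b_def[symmetric] inner_diff_left inner_diff_right
          inner_commute[of w v] right_diff_distrib)
      also have "\<dots> = u \<bullet> v" unfolding a b by simp
      finally show ?thesis .
    qed (simp add: f_def)
  qed
  moreover have "u \<bullet> y = u \<bullet> y' \<Longrightarrow> f u = u" for u
    by (simp add: f_def w_def inner_diff_right)
  ultimately show ?thesis using that by blast
qed

text \<open>Cones depend only on the line of their axis, so \<open>y'\<close> may be rescaled to the
  norm of \<open>y\<close>. The reflection exchanging the two axes fixes the all-ones vector, to
  which both are orthogonal.\<close>

lemma emeasure_near_invariant:
  fixes M :: "(real^'m) measure"
  assumes inv: "\<And>R y. orthogonal_matrix R \<Longrightarrow> R *v 1 = 1 \<Longrightarrow>
      emeasure M {v. near r v (R *v y)} = emeasure M {v. near r v y}"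
    and y: "y \<in> {v. v \<bullet> 1 = 0} - {0}" "y' \<in> {v. v \<bullet> 1 = 0} - {0}"
  shows "emeasure M {v. near r v y} = emeasure M {v. near r v y'}"
proof -
  define y'' where "y'' = (norm y / norm y') *\<^sub>R y'"
  have "norm y = norm y''" using y by (simp add: y''_def)
  then obtain f where f: "orthogonal_transformation f" "f y = y''"
    and fix_f: "\<And>u. u \<bullet> y = u \<bullet> y'' \<Longrightarrow> f u = u"
    using reflection_swapping by blast
  have app: "matrix f *v u = f u" for u
    using f(1) by (simp add: matrix_works orthogonal_transformation_linear)
  have "f 1 = 1" using y by (intro fix_f) (simp add: y''_def inner_commute)
  then have "emeasure M {v. near r v (matrix f *v y)} = emeasure M {v. near r v y}"
    using f(1) by (intro inv) (simp_all add: app orthogonal_transformation_matrix)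
  moreover have "near r v y'' \<longleftrightarrow> near r v y'" for v
    using y near_scaleR[of "norm y / norm y'" r y' v] by (simp add: y''_def near_commute[of r v])
  ultimately show ?thesis by (simp add: app f(2))
qed

section \<open>Orthogonal matrices acting on vectors and on point configurations\<close>

lemma orthogonal_matrix_inner:
  "orthogonal_matrix R \<Longrightarrow> (R *v u) \<bullet> (R *v v) = u \<bullet> (v :: real^'m)"
  using orthogonal_transformation_matrix[of "(*v) R"] by (simp add: orthogonal_transformation_def)

lemma orthogonal_matrix_near:
  "orthogonal_matrix R \<Longrightarrow> near r (R *v u) (R *v v) \<longleftrightarrow> near r u (v :: real^'m)"
  by (simp add: near_def orthogonal_matrix_inner)

text \<open>\<open>R\<close> mixes the points and acts in the same way on each coordinate column,
  and the inner product of configurations is the sum over the columns.\<close>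

lemma orthogonal_transformation_matrix_mul:
  fixes R :: "real^'m^'m"
  assumes "orthogonal_matrix R"
  shows "orthogonal_transformation (\<lambda>x :: real^'d^'m. R ** x)"
  unfolding orthogonal_transformation_def
proof (intro conjI allI)
  show "linear (\<lambda>x :: real^'d^'m. R ** x)"
    by (rule linearI) (simp_all add: matrix_add_ldistrib vec_eq_iff matrix_matrix_mult_def
      sum_distrib_left mult_ac distrib_left sum.distrib)
  have col: "x \<bullet> y = (\<Sum>j\<in>UNIV. column j x \<bullet> column j y)" for x y :: "real^'d^'m"
    unfolding inner_vec_def column_def by (simp add: inner_vec_def sum.swap[of _ "UNIV :: 'd set"])
  show "(R ** x) \<bullet> (R ** y) = x \<bullet> y" for x y :: "real^'d^'m"
    by (simp add: col column_matrix_mul orthogonal_matrix_inner[OF assms])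
qed

text \<open>As \<open>z \<bullet> 1\<close> is the sum of the coordinates, this is the orthogonal
  projection onto the hyperplane orthogonal to \<open>1\<close>; hence it commutes with every
  orthogonal matrix fixing \<open>1\<close>.\<close>

definition centered :: "real^'m \<Rightarrow> real^'m" where
  "centered z = z - ((z \<bullet> 1) / real CARD('m)) *\<^sub>R 1"

lemma centered_measurable [measurable]: "centered \<in> borel_measurable borel"
  unfolding centered_def by measurable

lemma aff_dep_measurable [measurable]: "aff_dep \<in> borel_measurable borel"
  by (rule borel_measurable_continuous_onI[OF continuous_aff_dep])

lemma near_fixed_measurable [measurable]: "Measurable.pred borel (\<lambda>v::'a::euclidean_space. near r v y)"
  using open_near[of r y] by (auto simp: near_commute[of r _ y] pred_def intro: borel_open)

lemma emeasure_distr_near: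
  fixes f :: "'b::euclidean_space \<Rightarrow> 'a::euclidean_space"
  assumes "f \<in> borel_measurable std_gauss"
  shows "emeasure (distr std_gauss borel f) {v. near r v y} = emeasure std_gauss {x. near r (f x) y}"
proof -
  have "{v. near r v y} \<in> sets borel" by measurable
  then show ?thesis using assms by (subst emeasure_distr) (auto simp: vimage_def)
qed

lemma inner_centered_one: "centered (z :: real^'m) \<bullet> 1 = 0"
proof -
  have "(1::real^'m) \<bullet> 1 = real CARD('m)" by (simp add: inner_vec_def)
  then show ?thesis by (simp add: centered_def inner_diff_left)
qed

text \<open>Each coordinate of \<open>centered z\<close> is a linear functional of \<open>z\<close>,
  nonzero as soon as there are two indices, so it vanishes only on a hyperplane.\<close>

lemma AE_centered_nth_nonzero:
  assumes "1 < CARD('m)"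
  shows "AE z in std_gauss. \<forall>i. centered (z :: real^'m) $ i \<noteq> 0"
proof (intro AE_std_gauss eventually_all_finite)
  show "AE z in lborel. centered (z :: real^'m) $ i \<noteq> 0" for i
  proof -
    define a :: "real^'m" where "a = axis i 1 - (1 / real CARD('m)) *\<^sub>R 1"
    have "a $ i \<noteq> 0" using assms by (simp add: a_def)
    then have "a \<noteq> 0" by auto
    then have "negligible {z. a \<bullet> z = 0}" by (rule negligible_hyperplane[OF disjI1])
    moreover have "{z. a \<bullet> z = 0} \<in> sets borel" by measurable
    ultimately have "{z. a \<bullet> z = 0} \<in> null_sets lborel"
      by (simp add: negligible_iff_null_sets null_sets_completion_iff)
    then have "AE z in lborel. z \<notin> {z. a \<bullet> z = 0}" by (rule AE_not_in)
    moreover have "a \<bullet> z = centered z $ i" for z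
      by (simp add: a_def centered_def inner_diff_left inner_axis' inner_commute[of z 1])
    ultimately show ?thesis by simp
  qed
qed

lemma aff_dep_centered_law:
  fixes U :: "(real^('d::finite option option)) set"
  assumes U: "open U" and cone: "\<And>c y. y \<in> U \<Longrightarrow> c \<noteq> 0 \<Longrightarrow> c *\<^sub>R y \<in> U"
  shows "emeasure (distr std_gauss borel (aff_dep :: real^'d^('d option option) \<Rightarrow> _)) U
       = emeasure (distr std_gauss borel centered) U"
proof -
  let ?A = "distr std_gauss borel (aff_dep :: real^'d^('d option option) \<Rightarrow> _)"
  let ?C = "distr std_gauss borel (centered :: real^('d option option) \<Rightarrow> _)"
  let ?V = "{v::real^('d option option). v \<bullet> 1 = 0}"
  have V: "?V - {0} \<in> sets borel" by measurable
  have A: "prob_space ?A" "sets ?A = sets borel"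
    by (auto intro!: prob_space.prob_space_distr prob_space_std_gauss)
  have C: "prob_space ?C" "sets ?C = sets borel"
    by (auto intro!: prob_space.prob_space_distr prob_space_std_gauss)
  have AEA: "AE v in ?A. v \<in> ?V - {0}"
    using AE_std_gauss[OF AE_aff_dep_nonzero] V by (subst AE_distr_iff) (auto simp: inner_aff_dep_one)
  have "AE z in std_gauss. centered (z :: real^('d option option)) \<noteq> 0"
    using AE_centered_nth_nonzero[where 'm="'d option option"]
    by (auto elim: eventually_mono)
  then have AEC: "AE v in ?C. v \<in> ?V - {0}"
    using V by (subst AE_distr_iff) (auto simp: inner_centered_one)
  have invA: "emeasure ?A {v. near r v y} = emeasure ?A {v. near r v y'}"
    if "0 < r" "y \<in> ?V - {0}" "y' \<in> ?V - {0}" for r y y'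
  proof (rule emeasure_near_invariant[OF _ that(2,3)])
    fix R :: "real^('d option option)^('d option option)" and y
    assume R: "orthogonal_matrix R" "R *v 1 = 1"
    have g: "orthogonal_transformation (\<lambda>x :: real^'d^('d option option). R ** x)"
      by (rule orthogonal_transformation_matrix_mul[OF R(1)])
    have [measurable]: "(\<lambda>x :: real^'d^('d option option). R ** x) \<in> borel_measurable borel"
      using orthogonal_transformation_linear[OF g]
      by (intro borel_measurable_continuous_onI linear_continuous_on linear_linear[THEN iffD2])
    \<comment> \<open>The factor \<open>det R\<close> in the equivariance drops out, since
      \<open>near\<close> ignores nonzero scalars.\<close>
    have "det R \<noteq> 0" using det_orthogonal_matrix[OF R(1)] by auto
    then have *: "near r (aff_dep (R ** x)) (R *v y) \<longleftrightarrow> near r (aff_dep x) y"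
      for x :: "real^'d^('d option option)"
      by (simp add: aff_dep_orthogonal[OF R] near_scaleR orthogonal_matrix_near[OF R(1)])
    have "emeasure ?A {v. near r v (R *v y)}
        = emeasure std_gauss {x :: real^'d^('d option option). near r (aff_dep x) (R *v y)}"
      by (rule emeasure_distr_near) measurable
    also have "\<dots> = emeasure (distr std_gauss borel (\<lambda>x. R ** x))
        {x :: real^'d^('d option option). near r (aff_dep x) (R *v y)}"
      by (simp add: distr_std_gauss_orthogonal[OF g])
    also have "\<dots> = emeasure std_gauss {x :: real^'d^('d option option). near r (aff_dep x) y}"
      by (subst emeasure_distr) (measurable, simp add: vimage_def *)
    also have "\<dots> = emeasure ?A {v. near r v y}"
      by (rule emeasure_distr_near[symmetric]) measurable
    finally show "emeasure ?A {v. near r v (R *v y)} = emeasure ?A {v. near r v y}" .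
  qed
  have invC: "emeasure ?C {v. near r v y} = emeasure ?C {v. near r v y'}"
    if "0 < r" "y \<in> ?V - {0}" "y' \<in> ?V - {0}" for r y y'
  proof (rule emeasure_near_invariant[OF _ that(2,3)])
    fix R :: "real^('d option option)^('d option option)" and y
    assume R: "orthogonal_matrix R" "R *v 1 = 1"
    have g: "orthogonal_transformation ((*v) R)"
      using R(1) by (simp add: orthogonal_transformation_matrix)
    have [measurable]: "((*v) R) \<in> borel_measurable borel"
      using orthogonal_transformation_linear[OF g]
      by (intro borel_measurable_continuous_onI linear_continuous_on linear_linear[THEN iffD2])
    have "centered (R *v z) = R *v centered z" for z
      using orthogonal_matrix_inner[OF R(1), of z 1]
      by (simp add: R(2) centered_def matrix_vector_mult_diff_distrib matrix_vector_mult_scaleR)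
    then have *: "near r (centered (R *v z)) (R *v y) \<longleftrightarrow> near r (centered z) y" for z
      by (simp add: orthogonal_matrix_near[OF R(1)])
    have "emeasure ?C {v. near r v (R *v y)} = emeasure std_gauss {z. near r (centered z) (R *v y)}"
      by (rule emeasure_distr_near) measurable
    also have "\<dots> = emeasure (distr std_gauss borel ((*v) R)) {z. near r (centered z) (R *v y)}"
      by (simp add: distr_std_gauss_orthogonal[OF g])
    also have "\<dots> = emeasure std_gauss {z. near r (centered z) y}"
      by (subst emeasure_distr) (measurable, simp add: vimage_def *)
    also have "\<dots> = emeasure ?C {v. near r v y}"
      by (rule emeasure_distr_near[symmetric]) measurable
    finally show "emeasure ?C {v. near r v (R *v y)} = emeasure ?C {v. near r v y}" .
  qed
  show ?thesis
  proof (rule antisym)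
    show "emeasure ?A U \<le> emeasure ?C U"
      by (rule directional_law_le[OF A(1) C(1) A(2) C(2) AEA AEC]) (fact invA, fact invC, fact U, fact cone)
    show "emeasure ?C U \<le> emeasure ?A U"
      by (rule directional_law_le[OF C(1) A(1) C(2) A(2) AEC AEA]) (fact invC, fact invA, fact U, fact cone)
  qed
qed

subsection \<open>Radon partitions and signs of the affine dependence\<close>

lemma radon_partition_reindex:
  assumes \<tau>: "bij_betw \<tau> I UNIV" and "A \<subseteq> I" "B \<subseteq> I"
  shows "radon_partition I (\<lambda>i. x (\<tau> i)) A B \<longleftrightarrow> radon_partition UNIV x (\<tau> ` A) (\<tau> ` B)"
proof -
  have inj: "inj_on \<tau> I" and im: "\<tau> ` I = UNIV" using \<tau> by (auto simp: bij_betw_def)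
  have "\<tau> ` A \<union> \<tau> ` B = UNIV \<longleftrightarrow> A \<union> B = I"
    using inj_on_image_eq_iff[OF inj, of "A \<union> B" I] assms im by (auto simp: image_Un)
  moreover have "\<tau> ` A \<inter> \<tau> ` B = {} \<longleftrightarrow> A \<inter> B = {}"
    using inj_on_image_Int[OF inj assms(2,3)] by auto
  ultimately show ?thesis by (simp add: radon_partition_def image_image)
qed

text \<open>Passes from points numbered by naturals to the index type on which the determinants
  live.\<close>

lemma radon_smaller_size_reindex:
  assumes \<tau>: "bij_betw \<tau> I UNIV"
  shows "radon_smaller_size I (\<lambda>i. x (\<tau> i)) = radon_smaller_size UNIV x"
proof -
  have inj: "inj_on \<tau> I" and im: "\<tau> ` I = UNIV" using \<tau> by (auto simp: bij_betw_def)
  have card: "card (\<tau> ` A) = card A" if "A \<subseteq> I" for A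
    using inj that by (intro card_image) (rule inj_on_subset)
  have "(\<exists>A B. radon_partition I (\<lambda>i. x (\<tau> i)) A B \<and> m = min (card A) (card B))
    \<longleftrightarrow> (\<exists>A B. radon_partition UNIV x A B \<and> m = min (card A) (card B))" (is "?L \<longleftrightarrow> ?R") for m
  proof
    assume ?L
    then obtain A B where *: "radon_partition I (\<lambda>i. x (\<tau> i)) A B" "m = min (card A) (card B)" by blast
    then have "A \<subseteq> I" "B \<subseteq> I" by (auto simp: radon_partition_def)
    then show ?R using * radon_partition_reindex[OF \<tau>, of A B x]
      by (intro exI[of _ "\<tau> ` A"] exI[of _ "\<tau> ` B"]) (simp add: card)
  next
    assume ?R
    then obtain A B where *: "radon_partition UNIV x A B" "m = min (card A) (card B)" by blast
    obtain A' where "A' \<subseteq> I" "A = \<tau> ` A'" using subset_imageE[of A \<tau> I] im by auto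
    moreover obtain B' where "B' \<subseteq> I" "B = \<tau> ` B'" using subset_imageE[of B \<tau> I] im by auto
    ultimately show ?L using * radon_partition_reindex[OF \<tau>, of A' B' x]
      by (intro exI[of _ A'] exI[of _ B']) (simp add: card)
  qed
  then show ?thesis unfolding radon_smaller_size_def by simp
qed

lemma radon_smaller_size_cong:
  assumes "\<And>i. i \<in> I \<Longrightarrow> x i = y i"
  shows "radon_smaller_size I x = radon_smaller_size I y"
proof -
  have "radon_partition I x A B \<longleftrightarrow> radon_partition I y A B" for A B
    using assms by (auto simp: radon_partition_def cong: image_cong_simp)
  then show ?thesis unfolding radon_smaller_size_def by simp
qed

text \<open>The weights belong to indices rather than points, so \<open>f\<close> may repeat values,
  in accordance with Radon partitions of index sets.\<close>

lemma in_convex_hull_image_iff: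
  fixes f :: "'i \<Rightarrow> 'e::real_vector"
  assumes "finite A"
  shows "p \<in> convex hull (f ` A) \<longleftrightarrow>
    (\<exists>u :: 'i \<Rightarrow> real. (\<forall>i\<in>A. 0 \<le> u i) \<and> sum u A = 1 \<and> (\<Sum>i\<in>A. u i *\<^sub>R f i) = p)"
proof
  let ?S = "{p. \<exists>u :: 'i \<Rightarrow> real. (\<forall>i\<in>A. 0 \<le> u i) \<and> sum u A = 1 \<and> (\<Sum>i\<in>A. u i *\<^sub>R f i) = p}"
  have "f ` A \<subseteq> ?S"
  proof safe
    fix i assume "i \<in> A"
    then show "\<exists>u :: 'i \<Rightarrow> real. (\<forall>j\<in>A. 0 \<le> u j) \<and> sum u A = 1 \<and> (\<Sum>j\<in>A. u j *\<^sub>R f j) = f i"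
      using assms by (intro exI[of _ "\<lambda>j. if j = i then 1 else 0"])
        (auto simp: if_distrib[of "\<lambda>c. c *\<^sub>R _"] cong: if_cong)
  qed
  moreover have "convex ?S"
  proof (rule convexI, clarify)
    fix u v :: "'i \<Rightarrow> real" and a b :: real
    assume "0 \<le> a" "0 \<le> b" "a + b = 1" "\<forall>i\<in>A. 0 \<le> u i" "\<forall>i\<in>A. 0 \<le> v i"
      "sum u A = 1" "sum v A = 1"
    then show "\<exists>w :: 'i \<Rightarrow> real. (\<forall>i\<in>A. 0 \<le> w i) \<and> sum w A = 1 \<and> (\<Sum>i\<in>A. w i *\<^sub>R f i)
        = a *\<^sub>R (\<Sum>i\<in>A. u i *\<^sub>R f i) + b *\<^sub>R (\<Sum>i\<in>A. v i *\<^sub>R f i)"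
      by (intro exI[of _ "\<lambda>i. a * u i + b * v i"])
        (simp add: sum.distrib sum_distrib_left[symmetric] scaleR_sum_right scaleR_add_left)
  qed
  ultimately have "convex hull (f ` A) \<subseteq> ?S" by (rule hull_minimal)
  then show "p \<in> convex hull (f ` A) \<Longrightarrow>
      \<exists>u :: 'i \<Rightarrow> real. (\<forall>i\<in>A. 0 \<le> u i) \<and> sum u A = 1 \<and> (\<Sum>i\<in>A. u i *\<^sub>R f i) = p" by blast
next
  assume "\<exists>u :: 'i \<Rightarrow> real. (\<forall>i\<in>A. 0 \<le> u i) \<and> sum u A = 1 \<and> (\<Sum>i\<in>A. u i *\<^sub>R f i) = p"
  then show "p \<in> convex hull (f ` A)"
    by (auto intro!: convex_sum[OF assms convex_convex_hull] hull_inc[OF imageI[of _ A f]])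
qed

text \<open>Disjointness lets the weights of the two convex combinations merge into one function;
  giving the part on \<open>B\<close> a minus sign turns it into an affine dependence.\<close>

lemma radon_partition_iff:
  fixes x :: "'m::finite \<Rightarrow> 'e::real_vector"
  shows "radon_partition UNIV x A B \<longleftrightarrow> A \<union> B = UNIV \<and> A \<inter> B = {} \<and>
    (\<exists>u :: 'm \<Rightarrow> real. (\<forall>i. 0 \<le> u i) \<and> sum u A = 1 \<and> sum u B = 1 \<and>
      (\<Sum>i\<in>A. u i *\<^sub>R x i) = (\<Sum>i\<in>B. u i *\<^sub>R x i))"
proof (cases "A \<union> B = UNIV \<and> A \<inter> B = {}")
  case True
  have fin: "finite A" "finite B" by simp_all
  have "convex hull (x ` A) \<inter> convex hull (x ` B) \<noteq> {} \<longleftrightarrow>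
    (\<exists>u v. ((\<forall>i\<in>A. 0 \<le> u i) \<and> sum u A = 1) \<and> ((\<forall>i\<in>B. 0 \<le> v i) \<and> sum v B = 1) \<and>
      (\<Sum>i\<in>A. u i *\<^sub>R x i) = (\<Sum>i\<in>B. v i *\<^sub>R x i))"
    unfolding ex_in_conv[symmetric] Int_iff in_convex_hull_image_iff[OF fin(1)]
      in_convex_hull_image_iff[OF fin(2)]
    by (auto 4 4)
  also have "\<dots> \<longleftrightarrow> (\<exists>u. (\<forall>i. 0 \<le> u i) \<and> sum u A = 1 \<and> sum u B = 1 \<and>
      (\<Sum>i\<in>A. u i *\<^sub>R x i) = (\<Sum>i\<in>B. u i *\<^sub>R x i))" (is "?L \<longleftrightarrow> ?R")
  proof
    assume ?L
    then obtain u v where uv: "\<forall>i\<in>A. 0 \<le> u i" "sum u A = 1" "\<forall>i\<in>B. 0 \<le> v i" "sum v B = 1"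
      "(\<Sum>i\<in>A. u i *\<^sub>R x i) = (\<Sum>i\<in>B. v i *\<^sub>R x i)" by blast
    define w where "w i = (if i \<in> A then u i else v i)" for i
    have "sum w A = sum u A" "(\<Sum>i\<in>A. w i *\<^sub>R x i) = (\<Sum>i\<in>A. u i *\<^sub>R x i)"
      by (auto simp: w_def intro!: sum.cong)
    moreover have "sum w B = sum v B" "(\<Sum>i\<in>B. w i *\<^sub>R x i) = (\<Sum>i\<in>B. v i *\<^sub>R x i)"
      using True by (auto simp: w_def intro!: sum.cong)
    moreover have "\<forall>i. 0 \<le> w i" using uv True by (auto simp: w_def)
    ultimately show ?R using uv by (intro exI[of _ w]) simp
  qed blast
  finally show ?thesis using True by (simp add: radon_partition_def)
qed (auto simp: radon_partition_def)

text \<open>The set is the projection of a closed set along the compact set of convex weights.\<close>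

lemma closed_radon_partition:
  "closed {x :: (real^'d)^'m. radon_partition UNIV (($) x) A B}"
proof (cases "A \<union> B = UNIV \<and> A \<inter> B = {}")
  case True
  let ?S = "{u :: real^'m. (\<Sum>i\<in>A. u $ i) = 1 \<and> (\<Sum>i\<in>B. u $ i) = 1}"
  let ?T = "{p :: (real^'m) \<times> ((real^'d)^'m).
    (\<Sum>i\<in>A. fst p $ i *\<^sub>R snd p $ i) = (\<Sum>i\<in>B. fst p $ i *\<^sub>R snd p $ i)}"
  have "closed ?S"
    by (intro closed_Collect_conj closed_Collect_eq continuous_intros)
  then have S: "compact (cbox 0 1 \<inter> ?S)" by (intro compact_Int_closed compact_cbox)
  have T: "closed ?T" by (intro closed_Collect_eq continuous_intros)
  have "radon_partition UNIV (($) x) A B \<longleftrightarrow> (\<exists>u. u \<in> cbox 0 1 \<inter> ?S \<and> (u, x) \<in> ?T)"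
    for x :: "(real^'d)^'m"
  proof -
    \<comment> \<open>Every weight is a term of one of two nonnegative sums equal to 1. The weights
      thus lie in the unit cube, which gives the compactness needed for the projection.\<close>
    have le1: "u i \<le> 1" if "\<forall>i. 0 \<le> u i" "sum u A = 1" "sum u B = 1" for u :: "'m \<Rightarrow> real" and i
    proof -
      have "i \<in> A \<or> i \<in> B" using True by blast
      then show ?thesis using that member_le_sum[of i A u] member_le_sum[of i B u] by auto
    qed
    show ?thesis
      unfolding radon_partition_iff
    proof
      assume "A \<union> B = UNIV \<and> A \<inter> B = {} \<and> (\<exists>u. (\<forall>i. 0 \<le> u i) \<and> sum u A = 1 \<and> sum u B = 1 \<and>
        (\<Sum>i\<in>A. u i *\<^sub>R x $ i) = (\<Sum>i\<in>B. u i *\<^sub>R x $ i))"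
      then obtain u where "\<forall>i. 0 \<le> u i" "sum u A = 1" "sum u B = 1"
        "(\<Sum>i\<in>A. u i *\<^sub>R x $ i) = (\<Sum>i\<in>B. u i *\<^sub>R x $ i)" by blast
      then show "\<exists>u. u \<in> cbox 0 1 \<inter> ?S \<and> (u, x) \<in> ?T"
        using le1[of u] by (intro exI[of _ "\<chi> i. u i"]) (simp add: mem_box_cart)
    next
      assume "\<exists>u. u \<in> cbox 0 1 \<inter> ?S \<and> (u, x) \<in> ?T"
      then obtain u where "u \<in> cbox 0 1 \<inter> ?S" "(u, x) \<in> ?T" by blast
      then show "A \<union> B = UNIV \<and> A \<inter> B = {} \<and> (\<exists>u. (\<forall>i. 0 \<le> u i) \<and> sum u A = 1 \<and> sum u B = 1 \<and>
        (\<Sum>i\<in>A. u i *\<^sub>R x $ i) = (\<Sum>i\<in>B. u i *\<^sub>R x $ i))"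
        using True by (intro conjI exI[of _ "($) u"]) (auto simp: mem_box_cart)
    qed
  qed
  then show ?thesis using closed_compact_projection[OF S T] by simp
next
  case False
  then have "{x :: (real^'d)^'m. radon_partition UNIV (($) x) A B} = {}"
    by (auto simp: radon_partition_def)
  then show ?thesis by simp
qed

text \<open>The size factors through the set of Radon partitions. There are finitely many such sets,
  and each value is attained on a Boolean combination of closed sets, degenerate configurations
  included.\<close>

lemma radon_smaller_size_sets:
  "{x :: (real^'d)^'m. radon_smaller_size UNIV (($) x) = k} \<in> sets borel"
proof -
  define pat where "pat x = {(A, B). radon_partition UNIV (($) x) A B}" for x :: "(real^'d)^'m"
  define size where "size P = (THE m. \<exists>A B. (A, B) \<in> P \<and> m = min (card A) (card B))"
    for P :: "('m set \<times> 'm set) set"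
  have "{x :: (real^'d)^'m. radon_smaller_size UNIV (($) x) = k}
      = (\<Union>P\<in>{P. size P = k}. {x. pat x = P})"
    by (auto simp: size_def pat_def radon_smaller_size_def)
  also have "\<dots> \<in> sets borel"
  proof (rule sets.finite_UN)
    fix P :: "('m set \<times> 'm set) set"
    have [measurable]: "Measurable.pred borel (\<lambda>x :: (real^'d)^'m. radon_partition UNIV (($) x) A B)" for A B
      unfolding pred_def using borel_closed[OF closed_radon_partition[of A B]] by simp
    have "{x. pat x = P} = {x. \<forall>q\<in>UNIV. radon_partition UNIV (($) x) (fst q) (snd q) \<longleftrightarrow> q \<in> P}"
      by (auto simp: pat_def)
    also have "\<dots> \<in> sets borel" by measurable
    finally show "{x. pat x = P} \<in> sets borel" .
  qed simp
  finally show ?thesis .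
qed

text \<open>The sign classes of \<open>aff_dep x\<close> form a Radon partition. Conversely, the
  signed weights of any Radon partition are a multiple of \<open>aff_dep x\<close>, so no weight
  vanishes and the signs determine both parts up to a swap.\<close>

lemma radon_smaller_size_eq_aff_dep:
  fixes x :: "real^'d^('d option option)"
  assumes nz: "\<And>i. aff_dep x $ i \<noteq> 0"
  shows "radon_smaller_size UNIV (($) x)
       = min (card {i. 0 < aff_dep x $ i}) (card {i. aff_dep x $ i < 0})"
proof -
  let ?l = "aff_dep x"
  let ?P = "{i. 0 < ?l $ i}" and ?N = "{i. ?l $ i < 0}"
  have PN: "?P \<union> ?N = UNIV" "?P \<inter> ?N = {}" using nz by (auto simp: neq_iff)
  have l0: "?l \<noteq> 0" using nz[of None] by auto
  have split: "sum g UNIV = sum g A + sum g B" if "A \<union> B = UNIV" "A \<inter> B = {}"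
    for g :: "'d option option \<Rightarrow> 'b::comm_monoid_add" and A B
    using sum.union_disjoint[of A B g] that by simp
  have sum0: "(\<Sum>i\<in>?P. ?l $ i) = (\<Sum>i\<in>?N. - ?l $ i)"
    using inner_aff_dep_one[of x] split[OF PN, of "($) ?l"] by (simp add: inner_vec_def sum_negf eq_neg_iff_add_eq_0)
  have vec0: "(\<Sum>i\<in>?P. ?l $ i *\<^sub>R x $ i) = (\<Sum>i\<in>?N. - ?l $ i *\<^sub>R x $ i)"
  proof -
    have "(\<Sum>i\<in>UNIV. ?l $ i *\<^sub>R x $ i) = 0"
      using inner_aff_dep_column[of x] by (simp add: vec_eq_iff inner_vec_def column_def)
    then show ?thesis using split[OF PN, of "\<lambda>i. ?l $ i *\<^sub>R x $ i"] by (simp add: sum_negf eq_neg_iff_add_eq_0)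
  qed
  have "?P \<noteq> {}"
  proof
    assume "?P = {}"
    then have "\<forall>i. ?l $ i < 0" using nz by (auto simp: neq_iff)
    then have "0 < (\<Sum>i\<in>UNIV. - ?l $ i)" by (intro sum_pos) auto
    then show False using inner_aff_dep_one[of x] by (simp add: inner_vec_def sum_negf)
  qed
  then have s: "0 < (\<Sum>i\<in>?P. ?l $ i)" by (intro sum_pos) auto
  have part: "radon_partition UNIV (($) x) ?P ?N"
    unfolding radon_partition_iff
  \<comment> \<open>The coordinates sum to 0, so the positive and the negative ones have the same
    total absolute value, and one divisor normalizes both sides.\<close>
  proof (intro conjI PN exI[of _ "\<lambda>i. \<bar>?l $ i\<bar> / (\<Sum>i\<in>?P. ?l $ i)"])
    let ?s = "\<Sum>i\<in>?P. ?l $ i"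
    show "\<forall>i. 0 \<le> \<bar>?l $ i\<bar> / ?s" using s by simp
    show "(\<Sum>i\<in>?P. \<bar>?l $ i\<bar> / ?s) = 1"
      using s by (simp add: sum_divide_distrib[symmetric])
    show "(\<Sum>i\<in>?N. \<bar>?l $ i\<bar> / ?s) = 1"
      using s sum0 by (simp add: sum_divide_distrib[symmetric] sum_negf)
    have "(\<Sum>i\<in>?P. (\<bar>?l $ i\<bar> / ?s) *\<^sub>R x $ i) = (1 / ?s) *\<^sub>R (\<Sum>i\<in>?P. ?l $ i *\<^sub>R x $ i)"
      by (simp add: scaleR_sum_right)
    also have "\<dots> = (\<Sum>i\<in>?N. (\<bar>?l $ i\<bar> / ?s) *\<^sub>R x $ i)"
      unfolding vec0 by (simp add: scaleR_sum_right)
    finally show "(\<Sum>i\<in>?P. (\<bar>?l $ i\<bar> / ?s) *\<^sub>R x $ i) = (\<Sum>i\<in>?N. (\<bar>?l $ i\<bar> / ?s) *\<^sub>R x $ i)" .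
  qed
  have uniq: "(A = ?P \<and> B = ?N) \<or> (A = ?N \<and> B = ?P)"
    if "radon_partition UNIV (($) x) A B" for A B
  proof -
    from that obtain u where AB: "A \<union> B = UNIV" "A \<inter> B = {}" and u: "\<And>i. 0 \<le> u i"
      "sum u A = 1" "sum u B = 1" "(\<Sum>i\<in>A. u i *\<^sub>R x $ i) = (\<Sum>i\<in>B. u i *\<^sub>R x $ i)"
      unfolding radon_partition_iff by blast
    define c :: "real^('d option option)" where "c = (\<chi> i. if i \<in> A then u i else - u i)"
    have cA: "(\<Sum>i\<in>A. c $ i *\<^sub>R f i) = (\<Sum>i\<in>A. u i *\<^sub>R f i)"
      and cB: "(\<Sum>i\<in>B. c $ i *\<^sub>R f i) = - (\<Sum>i\<in>B. u i *\<^sub>R f i)"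
      for f :: "_ \<Rightarrow> 'b::real_vector"
      using AB by (auto simp: c_def sum_negf[symmetric] intro!: sum.cong)
    have "c \<bullet> 1 = (\<Sum>i\<in>UNIV. c $ i *\<^sub>R (1::real))" by (simp add: inner_vec_def)
    then have c1: "c \<bullet> 1 = 0" unfolding split[OF AB] cA cB using u by simp
    have "(\<Sum>i\<in>UNIV. c $ i *\<^sub>R x $ i) = 0" unfolding split[OF AB] cA cB using u by simp
    then have "c \<bullet> column j x = 0" for j
      by (simp add: vec_eq_iff inner_vec_def column_def)
    then obtain t where t: "c = t *\<^sub>R ?l" using aff_dep_unique[OF l0 c1] by blast
    have "t \<noteq> 0"
    proof
      assume "t = 0"
      then have "(\<Sum>i\<in>A. c $ i *\<^sub>R (1::real)) = 0" using t by simp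
      then show False unfolding cA using u by simp
    qed
    then have c_nz: "c $ i \<noteq> 0" for i using t nz by simp
    have "u i \<noteq> 0" for i using c_nz[of i] by (auto simp: c_def split: if_splits)
    then have up: "0 < u i" for i using u(1)[of i] by (simp add: less_le)
    have "0 < c $ i \<longleftrightarrow> i \<in> A" "c $ i < 0 \<longleftrightarrow> i \<notin> A" for i
      using up[of i] by (simp_all add: c_def)
    then have A: "A = {i. 0 < c $ i}" and B: "B = {i. c $ i < 0}" using AB by auto
    show ?thesis
    proof (cases "t > 0")
      case True
      then show ?thesis unfolding A B t by (simp add: zero_less_mult_iff mult_less_0_iff)
    next
      case False
      then have "t < 0" using \<open>t \<noteq> 0\<close> by simp
      then show ?thesis unfolding A B t by (simp add: zero_less_mult_iff mult_less_0_iff)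
    qed
  qed
  show ?thesis
    unfolding radon_smaller_size_def
  proof (rule the_equality)
    show "\<exists>A B. radon_partition UNIV (($) x) A B \<and> min (card ?P) (card ?N) = min (card A) (card B)"
      using part by blast
    fix m assume "\<exists>A B. radon_partition UNIV (($) x) A B \<and> m = min (card A) (card B)"
    then obtain A B where "radon_partition UNIV (($) x) A B" "m = min (card A) (card B)" by blast
    then show "m = min (card ?P) (card ?N)" using uniq[of A B] by (auto simp: min.commute)
  qed
qed

subsection \<open>Order statistics\<close>

text \<open>In the ascending list the values satisfying \<open>Q\<close> form a final segment, and
  the \<open>k\<close>th largest sits at index \<open>n - k\<close>. A general \<open>Q\<close>
  covers both weak and strict comparison with the mean.\<close>

lemma upward_closed_kth_largest:
  assumes k: "1 \<le> k" "k \<le> n" and Q: "\<And>x y. Q x \<Longrightarrow> x \<le> y \<Longrightarrow> Q y"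
  shows "Q (kth_largest n z k) \<longleftrightarrow> k \<le> card {i. i < n \<and> Q (z i)}"
proof -
  define xs where "xs = sort (map z [0..<n])"
  have len: "length xs = n" and sorted: "sorted xs" by (simp_all add: xs_def)
  have kth: "kth_largest n z k = xs ! (n - k)"
    using k by (simp add: kth_largest_def xs_def[symmetric] rev_nth len)
  have "card {i. i < n \<and> Q (z i)} = length (filter Q (map z [0..<n]))"
    by (simp add: length_filter_conv_card cong: conj_cong)
  also have "\<dots> = size (filter_mset Q (mset xs))"
    unfolding xs_def mset_sort by (metis mset_filter size_mset)
  also have "\<dots> = card {j. j < n \<and> Q (xs ! j)}"
    by (metis mset_filter size_mset length_filter_conv_card len)
  finally have card: "card {i. i < n \<and> Q (z i)} = card {j. j < n \<and> Q (xs ! j)}" .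
  have mono: "i \<le> j \<Longrightarrow> j < n \<Longrightarrow> xs ! i \<le> xs ! j" for i j
    using sorted len by (simp add: sorted_nth_mono)
  show ?thesis
    unfolding card kth
  proof
    assume "Q (xs ! (n - k))"
    then have "{n - k..<n} \<subseteq> {j. j < n \<and> Q (xs ! j)}"
      using Q mono[of "n - k"] by auto
    then have "card {n - k..<n} \<le> card {j. j < n \<and> Q (xs ! j)}" by (intro card_mono) auto
    then show "k \<le> card {j. j < n \<and> Q (xs ! j)}" using k by simp
  next
    assume *: "k \<le> card {j. j < n \<and> Q (xs ! j)}"
    show "Q (xs ! (n - k))"
    proof (rule ccontr)
      assume nQ: "\<not> Q (xs ! (n - k))"
      have "{j. j < n \<and> Q (xs ! j)} \<subseteq> {n - k<..<n}"
      proof clarsimp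
        fix j assume j: "j < n" "Q (xs ! j)"
        show "n - k < j"
        proof (rule ccontr)
          assume "\<not> n - k < j"
          then have "xs ! j \<le> xs ! (n - k)" using k by (intro mono) auto
          then show False using Q j(2) nQ by blast
        qed
      qed
      then have "card {j. j < n \<and> Q (xs ! j)} \<le> card {n - k<..<n}" by (intro card_mono) auto
      then show False using * k by simp
    qed
  qed
qed

text \<open>The bound on the \<open>(k + 1)\<close>st largest is the negation of a strict
  comparison, so its count is strict while the other is weak. The two counts differ only when a
  sample equals \<open>m\<close>.\<close>

lemma kth_largest_between_iff:
  assumes "1 \<le> k" "k < n"
  shows "kth_largest n z (k + 1) \<le> m \<and> m \<le> kth_largest n z k \<longleftrightarrow>
    card {i. i < n \<and> m < z i} \<le> k \<and> k \<le> card {i. i < n \<and> m \<le> z i}"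
  using upward_closed_kth_largest[of k n "\<lambda>x. m \<le> x" z]
    upward_closed_kth_largest[of "k + 1" n "\<lambda>x. m < x" z] assms by auto

subsection \<open>Sign counts\<close>

text \<open>A finite union of open orthants; excluding zero coordinates removes their
  boundaries.\<close>

lemma open_sign_pattern:
  "open {v :: real^'m. (\<forall>i. v $ i \<noteq> 0) \<and> Q {i. 0 < v $ i} {i. v $ i < 0}}"
proof -
  have eq: "{v :: real^'m. (\<forall>i. v $ i \<noteq> 0) \<and> Q {i. 0 < v $ i} {i. v $ i < 0}}
      = (\<Union>S\<in>{S. Q S (- S)}. {v. \<forall>i. if i \<in> S then 0 < v $ i else v $ i < 0})" (is "?L = ?R")
  proof (intro set_eqI iffI)
    fix v assume v: "v \<in> ?L"
    then have "{i. v $ i < 0} = - {i. 0 < v $ i}" by (auto simp: neq_iff not_less dest: less_imp_le)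
    with v show "v \<in> ?R" by (auto intro!: bexI[of _ "{i. 0 < v $ i}"] simp: neq_iff)
  next
    fix v assume "v \<in> ?R"
    then obtain S where S: "Q S (- S)" and v: "\<And>i. if i \<in> S then 0 < v $ i else v $ i < 0" by auto
    have "0 < v $ i \<longleftrightarrow> i \<in> S" "v $ i < 0 \<longleftrightarrow> i \<notin> S" for i
      using v[of i] by (auto split: if_splits)
    then have "{i. 0 < v $ i} = S" "{i. v $ i < 0} = - S" by auto
    moreover have "v $ i \<noteq> 0" for i using v[of i] by (auto split: if_splits)
    ultimately show "v \<in> ?L" using S by simp
  qed
  have "open {v :: real^'m. \<forall>i. if i \<in> S then 0 < v $ i else v $ i < 0}" for S
  proof -
    have "open {v :: real^'m. if i \<in> S then 0 < v $ i else v $ i < 0}" for i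
      by (cases "i \<in> S") (auto intro!: open_Collect_less continuous_intros)
    then have "open (\<Inter>i. {v :: real^'m. if i \<in> S then 0 < v $ i else v $ i < 0})"
      by (intro open_INT) auto
    then show ?thesis by (simp add: Collect_all_eq)
  qed
  then show ?thesis unfolding eq by (intro open_UN ballI)
qed

lemma sign_sets_scaleR:
  fixes v :: "real^'m"
  shows "0 < c \<Longrightarrow> {i. 0 < (c *\<^sub>R v) $ i} = {i. 0 < v $ i} \<and> {i. (c *\<^sub>R v) $ i < 0} = {i. v $ i < 0}"
    and "c < 0 \<Longrightarrow> {i. 0 < (c *\<^sub>R v) $ i} = {i. v $ i < 0} \<and> {i. (c *\<^sub>R v) $ i < 0} = {i. 0 < v $ i}"
  by (auto simp: zero_less_mult_iff mult_less_0_iff)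

text \<open>Shaped for the comparison of the two laws: nonzero coordinates make it open, and the
  minimum makes it invariant under a change of sign.\<close>

definition smaller_sign_set :: "nat \<Rightarrow> (real^'m) set" where
  "smaller_sign_set k = {v. (\<forall>i. v $ i \<noteq> 0) \<and> min (card {i. 0 < v $ i}) (card {i. v $ i < 0}) = k}"

lemma open_smaller_sign_set: "open (smaller_sign_set k)"
  unfolding smaller_sign_set_def by (rule open_sign_pattern)

lemma smaller_sign_set_cone:
  assumes "v \<in> smaller_sign_set k" "c \<noteq> 0" shows "c *\<^sub>R v \<in> smaller_sign_set k"
proof (cases "0 < c")
  case True
  show ?thesis
    using assms sign_sets_scaleR(1)[OF True, of v] unfolding smaller_sign_set_def by simp
next
  case False
  then have "c < 0" using assms(2) by simp
  then show ?thesis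
    using assms sign_sets_scaleR(2)[of c v] unfolding smaller_sign_set_def by (simp add: min.commute)
qed

definition nonzero_set :: "(real^'m) set" where "nonzero_set = {v. \<forall>i. v $ i \<noteq> 0}"

lemma open_nonzero_set: "open nonzero_set"
  using open_sign_pattern[of "\<lambda>_ _. True"] by (simp add: nonzero_set_def)

text \<open>General position is inherited from the centered sample by the equality of the laws.\<close>

lemma AE_aff_dep_nth_nonzero:
  "AE x in std_gauss. \<forall>i. aff_dep (x :: real^'d^('d option option)) $ i \<noteq> 0"
proof -
  let ?A = "distr std_gauss borel (aff_dep :: real^'d^('d option option) \<Rightarrow> _)"
  let ?C = "distr std_gauss borel (centered :: real^('d option option) \<Rightarrow> _)"
  have meas: "nonzero_set \<in> sets borel" by (rule borel_open[OF open_nonzero_set])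
  interpret A: prob_space ?A
    by (auto intro!: prob_space.prob_space_distr prob_space_std_gauss)
  interpret C: prob_space ?C
    by (auto intro!: prob_space.prob_space_distr prob_space_std_gauss)
  have "AE z in std_gauss. \<forall>i. centered (z :: real^('d option option)) $ i \<noteq> 0"
    by (rule AE_centered_nth_nonzero) simp
  then have "AE v in ?C. v \<in> nonzero_set"
    using meas by (subst AE_distr_iff) (auto simp: nonzero_set_def)
  then have "emeasure ?C nonzero_set = 1"
    using C.emeasure_eq_1_AE[of nonzero_set] meas by simp
  then have "emeasure ?A nonzero_set = 1"
    by (subst aff_dep_centered_law[OF open_nonzero_set]) (auto simp: nonzero_set_def)
  then have "AE v in ?A. v \<in> nonzero_set"
    using A.emeasure_eq_1_AE[of nonzero_set] A.AE_prob_1[of nonzero_set] meas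
    by (simp add: A.emeasure_eq_measure)
  then show ?thesis
    using meas by (subst (asm) AE_distr_iff) (auto simp: nonzero_set_def)
qed

lemma emeasure_radon_smaller_size:
  "emeasure std_gauss {x :: real^'d^('d option option). radon_smaller_size UNIV (($) x) = k}
     = emeasure std_gauss {z :: real^('d option option). centered z \<in> smaller_sign_set k}"
proof -
  have S: "smaller_sign_set k \<in> sets borel" by (rule borel_open[OF open_smaller_sign_set])
  have "emeasure std_gauss {x :: real^'d^('d option option). radon_smaller_size UNIV (($) x) = k}
      = emeasure std_gauss {x :: real^'d^('d option option). aff_dep x \<in> smaller_sign_set k}"
  proof (rule emeasure_eq_AE)
    show "AE x in std_gauss. x \<in> {x :: real^'d^('d option option). radon_smaller_size UNIV (($) x) = k}
        \<longleftrightarrow> x \<in> {x. aff_dep x \<in> smaller_sign_set k}"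
      using AE_aff_dep_nth_nonzero
      by eventually_elim (simp add: radon_smaller_size_eq_aff_dep smaller_sign_set_def)
    show "{x :: real^'d^('d option option). aff_dep x \<in> smaller_sign_set k} \<in> sets std_gauss"
      using measurable_sets[OF aff_dep_measurable S] by (simp add: vimage_def)
  qed (simp add: radon_smaller_size_sets)
  also have "\<dots> = emeasure (distr std_gauss borel (aff_dep :: real^'d^('d option option) \<Rightarrow> _)) (smaller_sign_set k)"
    using S by (subst emeasure_distr) (auto simp: vimage_def)
  also have "\<dots> = emeasure (distr std_gauss borel centered)
      (smaller_sign_set k :: (real^('d option option)) set)"
    by (intro aff_dep_centered_law open_smaller_sign_set smaller_sign_set_cone)
  also have "\<dots> = emeasure std_gauss {z :: real^('d option option). centered z \<in> smaller_sign_set k}"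
    using S by (subst emeasure_distr) (auto simp: vimage_def)
  finally show ?thesis .
qed

section \<open>Gaussian probability of a sign count\<close>

lemma centered_uminus: "centered (- z) = - centered z"
  by (simp add: centered_def)

lemma pos_count_sets: "{z :: real^'m. card {i. 0 < centered z $ i} = k} \<in> sets borel"
proof -
  have "{v :: real^'m. card {i. 0 < v $ i} = k}
      = (\<Union>S\<in>{S. card S = k}. {v. \<forall>i\<in>UNIV. 0 < v $ i \<longleftrightarrow> i \<in> S})" by auto
  also have "\<dots> \<in> sets borel" by (rule sets.finite_UN) (simp, measurable)
  finally show ?thesis
    using measurable_sets[OF centered_measurable, of "{v :: real^'m. card {i. 0 < v $ i} = k}"]
    by (simp add: vimage_def)
qed

text \<open>The minimum is \<open>k\<close> iff \<open>k\<close> coordinates are positive or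
  \<open>k\<close> are negative; \<open>2 * k \<le> CARD('m)\<close> ensures that a class of size
  \<open>k\<close> is a smallest one. The map \<open>z\<close> to \<open>-z\<close> preserves the
  Gaussian measure and exchanges the two cases, which are disjoint unless both classes have size
  \<open>k\<close>.\<close>

lemma measure_smaller_sign_set:
  assumes m: "1 < CARD('m)" and k: "2 * k \<le> CARD('m)"
  shows "measure std_gauss {z :: real^'m. centered z \<in> smaller_sign_set k}
    = (if 2 * k = CARD('m) then 1 else 2)
      * measure std_gauss {z :: real^'m. card {i. 0 < centered z $ i} = k}"
proof -
  interpret prob_space "std_gauss :: (real^'m) measure" by (rule prob_space_std_gauss)
  let ?S = "{z :: real^'m. centered z \<in> smaller_sign_set k}"
  define P where "P = {z :: real^'m. (\<forall>i. centered z $ i \<noteq> 0) \<and> card {i. 0 < centered z $ i} = k}"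
  define N where "N = {z :: real^'m. (\<forall>i. centered z $ i \<noteq> 0) \<and> card {i. centered z $ i < 0} = k}"
  have opP: "open {v :: real^'m. (\<forall>i. v $ i \<noteq> 0) \<and> card {i. 0 < v $ i} = k}"
    by (rule open_sign_pattern[of "\<lambda>S T. card S = k"])
  have opN: "open {v :: real^'m. (\<forall>i. v $ i \<noteq> 0) \<and> card {i. v $ i < 0} = k}"
    by (rule open_sign_pattern[of "\<lambda>S T. card T = k"])
  have P_sets: "P \<in> sets borel" and N_sets: "N \<in> sets borel"
    using measurable_sets[OF centered_measurable borel_open[OF opP]]
      measurable_sets[OF centered_measurable borel_open[OF opN]]
    by (simp_all add: P_def N_def vimage_def)
  have total: "card {i. 0 < v $ i} + card {i. v $ i < 0} = CARD('m)"
    if "\<forall>i. v $ i \<noteq> 0" for v :: "real^'m"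
  proof -
    have "{i. 0 < v $ i} \<union> {i. v $ i < 0} = UNIV" using that by (auto simp: neq_iff)
    moreover have "{i. 0 < v $ i} \<inter> {i. v $ i < 0} = {}" by auto
    ultimately show ?thesis using card_Un_disjoint[of "{i. 0 < v $ i}" "{i. v $ i < 0}"] by simp
  qed
  have "?S = P \<union> N"
  proof (intro set_eqI iffI)
    fix z assume "z \<in> P \<union> N"
    then show "z \<in> ?S" using total[of "centered z"] k
      by (auto simp: P_def N_def smaller_sign_set_def)
  qed (auto simp: P_def N_def smaller_sign_set_def min_def split: if_splits)
  have "measure std_gauss N = measure (distr std_gauss borel uminus) N"
    by (subst distr_std_gauss_orthogonal) (simp_all add: orthogonal_transformation_neg)
  also have "\<dots> = measure std_gauss P"
    using N_sets by (subst measure_distr) (auto simp: P_def N_def vimage_def centered_uminus)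
  finally have NP: "measure std_gauss N = measure std_gauss P" .
  have "measure std_gauss ?S = (if 2 * k = CARD('m) then 1 else 2) * measure std_gauss P"
  proof (cases "2 * k = CARD('m)")
    case True
    then have "P = N" using total by (force simp: P_def N_def)
    then show ?thesis using \<open>?S = P \<union> N\<close> True by simp
  next
    case False
    then have "P \<inter> N = {}" using total by (force simp: P_def N_def)
    then have "measure std_gauss (P \<union> N) = measure std_gauss P + measure std_gauss N"
      using P_sets N_sets by (intro finite_measure_Union) auto
    then show ?thesis using \<open>?S = P \<union> N\<close> False NP by simp
  qed
  also have "measure std_gauss P = measure std_gauss {z :: real^'m. card {i. 0 < centered z $ i} = k}"
  proof (rule measure_eq_AE)
    show "AE z in std_gauss. z \<in> P \<longleftrightarrow> z \<in> {z :: real^'m. card {i. 0 < centered z $ i} = k}"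
      using AE_centered_nth_nonzero[OF m] by eventually_elim (simp add: P_def)
  qed (simp_all add: P_sets pos_count_sets)
  finally show ?thesis .
qed

lemma mean_between_prob_eq:
  fixes \<sigma> :: "'m::finite \<Rightarrow> nat"
  assumes \<sigma>: "bij_betw \<sigma> UNIV {..<n}" and k: "1 \<le> k" "k < n"
  shows "mean_between_prob n k = measure std_gauss {z :: real^'m. card {i. 0 < centered z $ i} = k}"
proof -
  let ?N = "Pi\<^sub>M {..<n} (\<lambda>_. std_normal_distribution)"
  let ?v = "\<lambda>z. (\<chi> i. z (\<sigma> i)) :: real^'m"
  have n: "CARD('m) = n" using bij_betw_same_card[OF \<sigma>] by simp
  have gauss1: "std_normal_distribution = std_gauss"
    by (simp add: std_gauss_def)
  interpret N: prob_space ?N by (intro prob_space_PiM prob_space_std_normal)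
  have comp: "distr ?N borel (\<lambda>z. z j) = std_normal_distribution" if "j \<in> {..<n}" for j
  proof -
    have "distr ?N borel (\<lambda>z. z j) = distr ?N std_normal_distribution (\<lambda>z. z j)"
      by (rule distr_cong) simp_all
    also have "\<dots> = std_normal_distribution"
      using that by (intro distr_PiM_component prob_space_std_normal) auto
    finally show ?thesis .
  qed
  have rv: "(\<lambda>z. z j) \<in> borel_measurable ?N" if "j \<in> {..<n}" for j
    using measurable_component_singleton[OF that, of "\<lambda>_. std_normal_distribution"] by simp
  have "N.indep_vars (\<lambda>_. borel) (\<lambda>j z. z j) {..<n}"
  proof (subst N.indep_vars_iff_distr_eq_PiM')
    have "distr ?N (Pi\<^sub>M {..<n} (\<lambda>_. borel)) (\<lambda>z. \<lambda>j\<in>{..<n}. z j) = distr ?N ?N (\<lambda>z. z)"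
      by (intro distr_cong refl sets_PiM_cong) (auto simp: space_PiM)
    also have "\<dots> = Pi\<^sub>M {..<n} (\<lambda>j. distr ?N borel (\<lambda>z. z j))"
      unfolding distr_id by (intro PiM_cong refl comp[symmetric])
    finally show "distr ?N (Pi\<^sub>M {..<n} (\<lambda>_. borel)) (\<lambda>z. \<lambda>j\<in>{..<n}. z j)
        = Pi\<^sub>M {..<n} (\<lambda>j. distr ?N borel (\<lambda>z. z j))" .
  qed (use k rv in auto)
  note law = distr_vec_std_gauss[OF N.prob_space_axioms this \<sigma> trans[OF comp gauss1]]
  have v_meas: "?v \<in> borel_measurable ?N" by (rule law(1))
  have v_distr: "distr ?N borel ?v = std_gauss" by (rule law(2))
  have mean: "centered (?v z) $ i = z (\<sigma> i) - sample_mean n z" for z i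
  proof -
    have "?v z \<bullet> 1 = (\<Sum>i\<in>UNIV. z (\<sigma> i))" by (simp add: inner_vec_def)
    also have "\<dots> = (\<Sum>j<n. z j)" by (rule sum.reindex_bij_betw[OF \<sigma>])
    finally show ?thesis by (simp add: centered_def sample_mean_def n)
  qed
  have \<sigma>_card: "card {i. Q (\<sigma> i)} = card {j. j < n \<and> Q j}" for Q
  proof (rule bij_betw_same_card)
    show "bij_betw \<sigma> {i. Q (\<sigma> i)} {j. j < n \<and> Q j}"
      by (rule bij_betw_subset[OF \<sigma>]) (use \<sigma> in \<open>auto simp: bij_betw_def\<close>)
  qed
  have count: "card {i. 0 < centered (?v z) $ i} = card {j. j < n \<and> sample_mean n z < z j}"
    "card {i. 0 \<le> centered (?v z) $ i} = card {j. j < n \<and> sample_mean n z \<le> z j}" for z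
    using \<sigma>_card[of "\<lambda>j. sample_mean n z < z j"] \<sigma>_card[of "\<lambda>j. sample_mean n z \<le> z j"]
    by (simp_all add: mean)
  let ?E = "{z :: real^'m. card {i. 0 < centered z $ i} = k}"
  \<comment> \<open>The event from the order statistics, with ties; it differs from
    \<open>?E\<close> only where some centered coordinate vanishes.\<close>
  let ?F = "{z :: real^'m. card {i. 0 < centered z $ i} \<le> k \<and> k \<le> card {i. 0 \<le> centered z $ i}}"
  have F: "?F \<in> sets borel"
  proof -
    have "{v :: real^'m. card {i. 0 < v $ i} \<le> k \<and> k \<le> card {i. 0 \<le> v $ i}}
        = (\<Union>(S, T)\<in>{(S, T). card S \<le> k \<and> k \<le> card T}.
            {v. \<forall>i\<in>UNIV. (0 < v $ i \<longleftrightarrow> i \<in> S) \<and> (0 \<le> v $ i \<longleftrightarrow> i \<in> T)})" by auto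
    also have "\<dots> \<in> sets borel" by (rule sets.finite_UN) (simp, auto)
    finally show ?thesis
      using measurable_sets[OF centered_measurable,
        of "{v :: real^'m. card {i. 0 < v $ i} \<le> k \<and> k \<le> card {i. 0 \<le> v $ i}}"]
      by (simp add: vimage_def)
  qed
  have "mean_between_prob n k = measure ?N (?v -` ?F \<inter> space ?N)"
    unfolding mean_between_prob_def Let_def kth_largest_between_iff[OF k] count[symmetric]
    by (rule arg_cong[where f="measure ?N"]) auto
  also have "\<dots> = measure std_gauss ?F"
    using measure_distr[OF v_meas, of ?F] F by (simp add: v_distr)
  also have "\<dots> = measure std_gauss ?E"
  proof (rule measure_eq_AE)
    have "1 < CARD('m)" using k n by simp
    from AE_centered_nth_nonzero[OF this] show "AE z in std_gauss. z \<in> ?F \<longleftrightarrow> z \<in> ?E"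
    proof eventually_elim
      case (elim z)
      then have "{i. 0 \<le> centered z $ i} = {i. 0 < centered z $ i}" by (auto simp: less_le)
      then show ?case by auto
    qed
  qed (use F pos_count_sets in auto)
  finally show ?thesis .
qed


theorem theorem4:
  fixes M :: "'a measure" and X :: "nat \<Rightarrow> 'a \<Rightarrow> real ^ 'd" and k :: nat
  assumes "prob_space M"
    and "prob_space.indep_vars M (\<lambda>_. borel) X {..<CARD('d) + 2}"
    and "\<And>i. i < CARD('d) + 2 \<Longrightarrow>
           distributed M lborel (X i) (\<lambda>x. ennreal (std_gaussian_density x))"
    and "1 \<le> k" and "k \<le> (CARD('d) + 2) div 2"
  shows "(real k \<noteq> real (CARD('d) + 2) / 2 \<longrightarrow>
           measure M {\<omega> \<in> space M. radon_smaller_size {..<CARD('d) + 2} (\<lambda>i. X i \<omega>) = k}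
             = 2 * mean_between_prob (CARD('d) + 2) k) \<and>
         (real k = real (CARD('d) + 2) / 2 \<longrightarrow>
           measure M {\<omega> \<in> space M. radon_smaller_size {..<CARD('d) + 2} (\<lambda>i. X i \<omega>) = k}
             = mean_between_prob (CARD('d) + 2) k)"
proof -
  let ?n = "CARD('d) + 2"
  interpret prob_space M by fact
  \<comment> \<open>Any numbering will do: the points are independent with equal laws, and the size
    of the smaller part does not depend on names.\<close>
  obtain \<sigma> :: "'d option option \<Rightarrow> nat" where \<sigma>: "bij_betw \<sigma> UNIV {..<?n}"
    using finite_same_card_bij[of "UNIV :: 'd option option set" "{..<?n}"] by auto
  define \<tau> where "\<tau> = inv_into UNIV \<sigma>"
  have \<tau>: "bij_betw \<tau> {..<?n} UNIV" unfolding \<tau>_def by (rule bij_betw_inv_into[OF \<sigma>])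
  have \<sigma>\<tau>: "\<sigma> (\<tau> i) = i" if "i < ?n" for i
    using bij_betw_inv_into_right[OF \<sigma>, of i] that by (simp add: \<tau>_def)
  have dens: "std_gaussian_density x = (\<Prod>b\<in>Basis. std_normal_density (x \<bullet> b))" for x :: "real^'d"
  proof -
    have B: "(Basis :: (real^'d) set) = (\<lambda>j. axis j 1) ` UNIV" by (auto simp: Basis_vec_def)
    show ?thesis
      unfolding std_gaussian_density_def B
      by (subst prod.reindex) (auto simp: inj_on_def axis_eq_axis inner_axis)
  qed
  have law: "distr M borel (X i) = std_gauss" if "i \<in> {..<?n}" for i
  proof -
    have "distr M borel (X i) = distr M lborel (X i)" by (rule distr_cong) simp_all
    also have "\<dots> = std_gauss"
      using assms(3)[of i] that by (simp add: distributed_def std_gauss_def dens)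
    finally show ?thesis .
  qed
  define Y where "Y \<omega> = (\<chi> i. X (\<sigma> i) \<omega>)" for \<omega>
  have Y: "Y \<in> borel_measurable M" "distr M borel Y = std_gauss"
    unfolding Y_def using distr_vec_std_gauss[OF assms(1,2) \<sigma> law] by blast+
  have size: "radon_smaller_size {..<?n} (\<lambda>i. X i \<omega>) = radon_smaller_size UNIV (($) (Y \<omega>))" for \<omega>
  proof -
    have "radon_smaller_size {..<?n} (\<lambda>i. X i \<omega>) = radon_smaller_size {..<?n} (\<lambda>i. Y \<omega> $ \<tau> i)"
      by (rule radon_smaller_size_cong) (simp add: Y_def \<sigma>\<tau>)
    also have "\<dots> = radon_smaller_size UNIV (($) (Y \<omega>))" by (rule radon_smaller_size_reindex[OF \<tau>])
    finally show ?thesis .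
  qed
  have "measure M {\<omega> \<in> space M. radon_smaller_size {..<?n} (\<lambda>i. X i \<omega>) = k}
      = measure (distr M borel Y) {x. radon_smaller_size UNIV (($) x) = k}"
    unfolding size by (subst measure_distr[OF Y(1)]) (auto simp: radon_smaller_size_sets intro!: arg_cong[where f="measure M"])
  also have "\<dots> = measure std_gauss {z :: real^('d option option). centered z \<in> smaller_sign_set k}"
    unfolding Y(2) by (simp only: measure_def emeasure_radon_smaller_size)
  also have "\<dots> = (if 2 * k = ?n then 1 else 2)
      * measure std_gauss {z :: real^('d option option). card {i. 0 < centered z $ i} = k}"
    using assms(5) by (subst measure_smaller_sign_set) auto
  also have "measure std_gauss {z :: real^('d option option). card {i. 0 < centered z $ i} = k}
      = mean_between_prob ?n k"
    using mean_between_prob_eq[OF \<sigma> assms(4)] assms(4,5) by simp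
  finally show ?thesis
    by (auto simp: field_simps)
qed

end
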